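(* For every integer $N\ge1$, the minimal periodic logarithmic energy of the unit interval satisfies $$\mathcal E_{\log}^{\mathrm p}([0,1),N)=2N\left(\sqrt\pi\,(N-1)-\log(N)\right).$$
   Context: Here $d=1$ and the lattice is $\mathbb Z$. The logarithmic potential is $f(x)=\log|x|^{-2}$, with associated measure $t^{-1}\,dt$ on $(0,\infty)$, and its periodic kernel is $$K_{\log}^{\mathrm p}(x,y)=\sum_{v\in\mathbb Z}\int_1^\infty \frac{e^{-|x-y+v|^2t}}{t}\,dt+\sum_{w\in\mathbb Z\setminus\{0\}}e^{2\pi i w(x-y)}\int_0^1\frac{\pi^{1/2}}{t^{3/2}}e^{-\pi^2w^2/t}\,dt.$$ Then $\mathcal E_{\log}^{\mathrm p}([0,1),N)=\inf\{\sum_{j\ne k}K_{\log}^{\mathrm p}(x_j,x_k):(x_j)_{j=1}^N\in[0,1)^N\}$. *)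

theory Defs
  imports "HOL-Analysis.Analysis"
begin

text \<open>
  The periodic logarithmic kernel on the real line (lattice of integers).  It is
  the sum of a real-space part, a sum of integrals of positive functions, and of
  a Fourier part, an absolutely convergent series.  On the diagonal (x - y an
  integer) the real-space part is infinite.  It is therefore a nonnegative
  (Lebesgue) integral, so that coinciding points get infinite energy; a Bochner
  integral would assign the value 0 to the divergent term.
\<close>

definition log_kernel_real_part :: "real \<Rightarrow> real \<Rightarrow> ennreal" where
  "log_kernel_real_part x y =
     (\<Sum>\<^sub>\<infinity>v\<in>(UNIV :: int set).
        (\<integral>\<^sup>+ t\<in>{1..}. ennreal (exp (- (\<bar>x - y + of_int v\<bar>\<^sup>2 * t)) / t) \<partial>lborel))"

definition log_kernel_fourier_part :: "real \<Rightarrow> real \<Rightarrow> complex" where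
  "log_kernel_fourier_part x y =
     (\<Sum>\<^sub>\<infinity>w\<in>(UNIV - {0} :: int set).
        exp (2 * of_real pi * \<i> * of_int w * of_real (x - y)) *
        of_real (LINT t:{0<..1}|lborel.
          pi powr (1/2) / t powr (3/2) * exp (- (pi\<^sup>2 * (of_int w)\<^sup>2 / t))))"

text \<open>
  The Fourier part is real: the terms for w and -w are complex conjugates.
  Hence taking its real part in the kernel below discards nothing.
\<close>

lemma log_kernel_fourier_part_real: "log_kernel_fourier_part x y \<in> \<real>"
proof -
  let ?f = "\<lambda>w::int. exp (2 * of_real pi * \<i> * of_int w * of_real (x - y)) *
        complex_of_real (LINT t:{0<..1}|lborel.
          pi powr (1/2) / t powr (3/2) * exp (- (pi\<^sup>2 * (of_int w)\<^sup>2 / t)))"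
  have "cnj (log_kernel_fourier_part x y) = (\<Sum>\<^sub>\<infinity>w\<in>UNIV - {0}. cnj (?f w))"
    unfolding log_kernel_fourier_part_def by (simp only: infsum_cnj)
  also have "\<dots> = (\<Sum>\<^sub>\<infinity>w\<in>UNIV - {0}. ?f (- w))"
    by (intro infsum_cong) (simp add: exp_cnj)
  also have "\<dots> = (\<Sum>\<^sub>\<infinity>w\<in>UNIV - {0}. ?f w)"
    by (rule infsum_reindex_bij_betw[of uminus "UNIV - {0}" "UNIV - {0}" ?f])
       (auto intro!: bij_betwI[of _ _ _ uminus])
  finally show ?thesis
    by (simp add: Reals_cnj_iff log_kernel_fourier_part_def)
qed

definition periodic_log_kernel :: "real \<Rightarrow> real \<Rightarrow> ereal" where
  "periodic_log_kernel x y =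
     enn2ereal (log_kernel_real_part x y) + ereal (Re (log_kernel_fourier_part x y))"

text \<open>
  Points are indexed by 1, ..., N; the sum runs over ordered pairs of distinct
  indices (the points themselves may coincide).  The kernel never takes the
  value minus infinity, so the extended-real sums are unproblematic.
\<close>

definition periodic_log_energy :: "real set \<Rightarrow> nat \<Rightarrow> ereal" where
  "periodic_log_energy A N =
     (INF x \<in> {1..N} \<rightarrow>\<^sub>E A.
        \<Sum>(j, k) \<in> {(j, k). j \<in> {1..N} \<and> k \<in> {1..N} \<and> j \<noteq> k}. periodic_log_kernel (x j) (x k))"

end

theory Submission
  imports
    Defs
    "HOL-Probability.Characteristic_Functions"
    "HOL-Computational_Algebra.Fundamental_Theorem_Algebra"
begin

text \<open>
  By Poisson summation, the theta function \<open>\<theta>(t, x)\<close>, the sum of \<open>exp (- (x + v)\<^sup>2 * t)\<close> over the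
  integers \<open>v\<close>, is a cosine series for every \<open>t\<close>. Dividing by \<open>t\<close>, it has the explicit antiderivative
  \<open>F t = - 2 * sqrt pi / sqrt t + (\<Sum>w\<ge>1. 2 * cos (2 * pi * w * x) * erfc (pi * w / sqrt t) / w)\<close>.
  The real-space part of the kernel is \<open>F \<infinity> - F 1\<close>, and the Fourier part is the sum in \<open>F 1\<close>, so that the
  kernel is \<open>F \<infinity> + 2 * sqrt pi\<close>. Abel summation shows that \<open>F \<infinity>\<close> is the sum of
  \<open>2 * cos (2 * pi * w * x) / w\<close>, hence the kernel is \<open>2 * sqrt pi - 2 * ln \<bar>1 - exp (2 * pi * \<i> * (x - y))\<bar>\<close>.

  For sorted points and fixed \<open>k\<close>, the gaps between a point and its \<open>k\<close>-th cyclic successor add up to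
  \<open>k\<close>, so concavity of \<open>ln (sin (pi * u))\<close> bounds the contribution of these pairs by the one of
  equidistant points, which follows from \<open>(\<Prod>k=1..<N. 1 - exp (2 * pi * \<i> * k / N)) = N\<close>.
\<close>

section \<open>Uniqueness of Fourier coefficients\<close>

text \<open>Generated by monomials and sums, so that products and orthogonality go by rule
  induction, without coefficient families.\<close>

inductive trig_poly :: "(real \<Rightarrow> complex) \<Rightarrow> bool" where
  monomial: "trig_poly (\<lambda>x. c * cis (2 * pi * of_int w * x))"
| add: "trig_poly f \<Longrightarrow> trig_poly g \<Longrightarrow> trig_poly (\<lambda>x. f x + g x)"

lemma trig_poly_mult:
  assumes "trig_poly f" "trig_poly g"
  shows "trig_poly (\<lambda>x. f x * g x)"
  using assms
proof (induction rule: trig_poly.induct)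
  case f: (monomial c w)
  show ?case
    using f.prems
  proof (induction rule: trig_poly.induct)
    case (monomial c' w')
    have "(\<lambda>x. (c * cis (2 * pi * of_int w * x)) * (c' * cis (2 * pi * of_int w' * x)))
        = (\<lambda>x. (c * c') * cis (2 * pi * of_int (w + w') * x))"
      by (auto simp: fun_eq_iff cis_mult[symmetric] algebra_simps)
    then show ?case
      by (simp only: trig_poly.monomial)
  next
    case (add f g)
    then show ?case
      by (auto simp: distrib_left intro: trig_poly.add)
  qed
next
  case (add f g)
  then show ?case
    by (auto simp: distrib_right intro: trig_poly.add)
qed

text \<open>Links Stone-Weierstrass, whose approximants are real polynomials in the coordinates of
  the circle, to exponentials: a real linear form restricted to the circle uses only the frequencies
  1 and -1.\<close>

lemma trig_poly_real_polynomial_function: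
  fixes p :: "complex \<Rightarrow> real"
  assumes "real_polynomial_function p"
  shows "trig_poly (\<lambda>x. of_real (p (cis (2 * pi * x))))"
  using assms
proof induction
  case (linear p)
  interpret bounded_linear p by fact
  \<comment> \<open>Chosen so that \<open>p z = c * z + cnj c * cnj z\<close>; on the circle
    \<open>cnj z\<close> is the monomial of frequency -1.\<close>
  define c where "c = Complex (p 1) (- p \<i>) / 2"
  have eq: "p z = Re z * p 1 + Im z * p \<i>" for z
  proof -
    have "z = Re z *\<^sub>R 1 + Im z *\<^sub>R \<i>"
      by (simp add: complex_eq_iff)
    then have "p z = p (Re z *\<^sub>R 1 + Im z *\<^sub>R \<i>)"
      by (rule arg_cong)
    then show ?thesis
      by (simp only: add scaleR real_scaleR_def)
  qed
  have "(\<lambda>x. complex_of_real (p (cis (2 * pi * x))))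
      = (\<lambda>x. c * cis (2 * pi * of_int 1 * x) + cnj c * cis (2 * pi * of_int (-1) * x))"
    by (subst eq) (auto simp: fun_eq_iff complex_eq_iff c_def field_simps)
  then show ?case
    by (simp only:) (intro trig_poly.intros)
next
  case (const c)
  show ?case
    using trig_poly.monomial[of "of_real c" 0] by simp
next
  case (add f g)
  then show ?case by (auto intro: trig_poly.add)
next
  case (mult f g)
  then show ?case by (auto intro: trig_poly_mult)
qed

lemma trig_poly_continuous: "trig_poly f \<Longrightarrow> continuous_on A f"
  by (induction rule: trig_poly.induct) (auto intro!: continuous_intros)

text \<open>Continuity across the cut of \<open>Arg2pi\<close> at 1 rests on
  \<open>f 0 = f 1\<close>: the loop \<open>f\<close> is homotopic to itself, and homotopic loops
  induce homotopic, hence continuous, maps on the circle.\<close>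

lemma continuous_on_circle_lift:
  fixes f :: "real \<Rightarrow> 'a::real_normed_vector"
  assumes "continuous_on {0..1} f" "f 0 = f 1"
  shows "continuous_on (sphere 0 1) (\<lambda>z. f (Arg2pi z / (2 * pi)))"
proof -
  have "homotopic_loops UNIV f f"
    using assms by (simp add: homotopic_loops_refl path_def pathfinish_def pathstart_def)
  from homotopic_with_imp_continuous[OF homotopic_loops_imp_homotopic_circlemaps[OF this]]
  show ?thesis by (simp add: o_def)
qed

text \<open>Let a trigonometric polynomial \<open>g\<close> be within \<open>e\<close> of
  \<open>f\<close>. Orthogonality of \<open>f\<close> to \<open>g\<close> turns the integral of
  \<open>f^2\<close> into that of \<open>f * (f - g)\<close>, which is at most \<open>e\<close>
  times the integral of \<open>\<bar>f\<bar>\<close>. As \<open>e\<close> is arbitrary,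
  \<open>f^2\<close> has integral 0.\<close>

theorem fourier_uniqueness:
  fixes f :: "real \<Rightarrow> real"
  assumes cont: "continuous_on {0..1} f" and per: "f 0 = f 1"
    and coeff: "\<And>w::int. integral {0..1} (\<lambda>x. of_real (f x) * cis (2 * pi * of_int w * x)) = 0"
    and x: "x \<in> {0..1}"
  shows "f x = 0"
proof -
  define F where "F z = f (Arg2pi z / (2 * pi))" for z
  have F_cis: "F (cis (2 * pi * x)) = f x" if "x \<in> {0..1}" for x
  proof (cases "x = 1")
    case True
    then show ?thesis by (simp add: F_def per Arg2pi_of_real[of 1, simplified])
  next
    case False
    have "Arg2pi (cis (2 * pi * x)) = 2 * pi * x"
      using that False by (intro Arg2pi_unique[where r = 1]) (auto simp: cis_conv_exp)
    then show ?thesis by (simp add: F_def)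
  qed
  have F_cont: "continuous_on (sphere 0 1) F"
    unfolding F_def by (rule continuous_on_circle_lift[OF cont per])
  have orth: "integral {0..1} (\<lambda>x. of_real (f x) * g x) = 0" if "trig_poly g" for g
    using that
  proof induction
    case (monomial c w)
    have "(\<lambda>x. of_real (f x) * (c * cis (2 * pi * of_int w * x)))
        = (\<lambda>x. c * (of_real (f x) * cis (2 * pi * of_int w * x)))"
      by (simp add: fun_eq_iff)
    then show ?case using coeff[of w] by simp
  next
    case (add g h)
    have "integral {0..1} (\<lambda>x. of_real (f x) * g x + of_real (f x) * h x)
        = integral {0..1} (\<lambda>x. of_real (f x) * g x) + integral {0..1} (\<lambda>x. of_real (f x) * h x)"
      by (intro integral_add integrable_continuous_real continuous_intros cont
                trig_poly_continuous add.hyps)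
    then show ?case by (simp add: add.IH distrib_left)
  qed
  define I where "I = integral {0..1} (\<lambda>x. f x ^ 2)"
  define J where "J = integral {0..1} (\<lambda>x. \<bar>f x\<bar>)"
  have le: "I \<le> e * J" if "e > 0" for e
  proof -
    obtain p where p: "real_polynomial_function p"
        and approx: "\<And>z. z \<in> sphere 0 1 \<Longrightarrow> \<bar>F z - p z\<bar> < e"
      using Stone_Weierstrass_real_polynomial_function[OF compact_sphere F_cont \<open>e > 0\<close>] by blast
    define g where "g x = p (cis (2 * pi * x))" for x
    have tp: "trig_poly (\<lambda>x. of_real (g x))"
      unfolding g_def by (rule trig_poly_real_polynomial_function[OF p])
    have g_cont: "continuous_on {0..1} g"
      using continuous_on_Re[OF trig_poly_continuous[OF tp]] by simp
    have "((\<lambda>x. complex_of_real (f x * g x)) has_integral of_real (integral {0..1} (\<lambda>x. f x * g x))) {0..1}"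
      by (intro has_integral_of_real integrable_integral integrable_continuous_real
                continuous_intros cont g_cont)
    then have "integral {0..1} (\<lambda>x. f x * g x) = 0"
      using orth[OF tp] by (simp add: integral_unique)
    then have "I = integral {0..1} (\<lambda>x. f x ^ 2 - f x * g x)"
      unfolding I_def
      by (subst integral_diff)
         (auto intro!: integrable_continuous_real continuous_intros cont g_cont)
    also have "\<dots> \<le> integral {0..1} (\<lambda>x. e * \<bar>f x\<bar>)"
    proof (rule integral_le)
      show "f x ^ 2 - f x * g x \<le> e * \<bar>f x\<bar>" if "x \<in> {0..1}" for x
      proof -
        have "f x ^ 2 - f x * g x = (f x - g x) * f x"
          by (simp add: power2_eq_square algebra_simps)
        also have "\<dots> \<le> \<bar>f x - g x\<bar> * \<bar>f x\<bar>"
          by (metis abs_ge_self abs_mult)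
        also have "\<dots> \<le> e * \<bar>f x\<bar>"
          using approx[of "cis (2 * pi * x)"] F_cis[OF that]
          by (intro mult_right_mono) (auto simp: g_def)
        finally show ?thesis .
      qed
    qed (auto intro!: integrable_continuous_real continuous_intros cont g_cont)
    also have "\<dots> = e * J" by (simp add: J_def)
    finally show ?thesis .
  qed
  have J: "J \<ge> 0" unfolding J_def by (intro integral_nonneg integrable_continuous_real continuous_intros cont) auto
  have "I \<le> 0"
  proof (rule field_le_epsilon)
    fix e :: real assume "e > 0"
    have "I \<le> e / (J + 1) * J" using J \<open>e > 0\<close> by (intro le) auto
    also have "\<dots> \<le> e" using J \<open>e > 0\<close> by (simp add: field_simps)
    finally show "I \<le> 0 + e" by simp
  qed
  moreover have "I \<ge> 0" unfolding I_def by (intro integral_nonneg integrable_continuous_real continuous_intros cont) auto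
  ultimately have "((\<lambda>x. f x ^ 2) has_integral 0) (cbox 0 1)"
    using integrable_integral[OF integrable_continuous_real[of 0 1 "\<lambda>x. f x ^ 2"]] cont
    by (auto simp: I_def intro!: continuous_intros)
  then have "f x ^ 2 = 0"
    using x by (intro has_integral_0_cbox_imp_0[of 0 1 "\<lambda>x. f x ^ 2"]) (auto intro!: continuous_intros cont)
  then show ?thesis by simp
qed

section \<open>Power series on the unit circle\<close>

text \<open>Multiplication by \<open>1 - z\<close> turns the series into an absolutely convergent one with
  coefficients \<open>c n - c (n + 1)\<close>.\<close>

lemma dirichlet_power_series:
  fixes z :: complex and c :: "nat \<Rightarrow> real"
  assumes z: "norm z = 1" "z \<noteq> 1" and c: "decseq c" "c \<longlonglongrightarrow> 0"
  shows "summable (\<lambda>n. c n *\<^sub>R z ^ n)"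
    and "norm (\<Sum>n. c n *\<^sub>R z ^ n) \<le> 2 * c 0 / norm (1 - z)"
proof -
  define d where "d n = c n - c (Suc n)" for n
  have d: "d n \<ge> 0" for n using c(1) by (simp add: d_def decseq_Suc_iff)
  have d_sums: "d sums c 0"
    unfolding d_def using telescope_sums'[OF c(2)] by simp
  have c0: "c 0 \<ge> 0" using d_sums d by (metis sums_le sums_zero)
  have sm: "summable (\<lambda>n. norm (d n *\<^sub>R z ^ Suc n))"
    using sums_summable[OF d_sums] d z by (simp add: norm_mult norm_power)
  define R where "R = (\<Sum>n. d n *\<^sub>R z ^ Suc n)"
  have R_sums: "(\<lambda>n. d n *\<^sub>R z ^ Suc n) sums R"
    unfolding R_def by (intro summable_sums summable_norm_cancel[OF sm])
  have R: "norm R \<le> c 0"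
  proof -
    have "norm R \<le> (\<Sum>n. norm (d n *\<^sub>R z ^ Suc n))"
      unfolding R_def by (rule summable_norm[OF sm])
    also have "(\<lambda>n. norm (d n *\<^sub>R z ^ Suc n)) = d"
      using d z by (simp add: fun_eq_iff norm_mult norm_power)
    finally show ?thesis using sums_unique[OF d_sums] by simp
  qed
  have part: "(1 - z) * (\<Sum>n<m. c n *\<^sub>R z ^ n)
      = c 0 *\<^sub>R 1 - (\<Sum>n<m. d n *\<^sub>R z ^ Suc n) - c m *\<^sub>R z ^ m" for m
    by (induction m) (auto simp: d_def algebra_simps scaleR_conv_of_real)
  have "(\<lambda>m. c m *\<^sub>R z ^ m) \<longlonglongrightarrow> 0"
    by (rule tendsto_norm_zero_cancel)
       (use z tendsto_norm_zero[OF c(2)] in \<open>simp add: norm_power\<close>)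
  then have "(\<lambda>m. (c 0 *\<^sub>R 1 - (\<Sum>n<m. d n *\<^sub>R z ^ Suc n) - c m *\<^sub>R z ^ m) / (1 - z))
      \<longlonglongrightarrow> (c 0 *\<^sub>R 1 - R - 0) / (1 - z)"
    using R_sums z unfolding sums_def by (intro tendsto_intros) auto
  also have "(\<lambda>m. (c 0 *\<^sub>R 1 - (\<Sum>n<m. d n *\<^sub>R z ^ Suc n) - c m *\<^sub>R z ^ m) / (1 - z))
      = (\<lambda>m. \<Sum>n<m. c n *\<^sub>R z ^ n)"
    unfolding part[symmetric] using z by simp
  finally have sums: "(\<lambda>n. c n *\<^sub>R z ^ n) sums ((c 0 *\<^sub>R 1 - R) / (1 - z))"
    by (simp add: sums_def)
  then show "summable (\<lambda>n. c n *\<^sub>R z ^ n)" by (rule sums_summable)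
  have "norm (\<Sum>n. c n *\<^sub>R z ^ n) = norm (c 0 *\<^sub>R 1 - R) / norm (1 - z)"
    by (simp only: sums_unique[OF sums, symmetric] norm_divide)
  also have "\<dots> \<le> (c 0 + c 0) / norm (1 - z)"
    using R c0 norm_triangle_ineq4[of "c 0 *\<^sub>R 1" R] by (intro divide_right_mono) auto
  finally show "norm (\<Sum>n. c n *\<^sub>R z ^ n) \<le> 2 * c 0 / norm (1 - z)" by simp
qed

text \<open>The tail is \<open>z ^ m\<close> times the series with coefficients
  \<open>c (n + m)\<close>, which again decrease to 0. The bound involves only the first omitted
  coefficient, so it can be made uniform over families of coefficients.\<close>

lemma dirichlet_power_series_tail:
  fixes z :: complex and c :: "nat \<Rightarrow> real"
  assumes z: "norm z = 1" "z \<noteq> 1" and c: "decseq c" "c \<longlonglongrightarrow> 0"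
  shows "norm ((\<Sum>n. c n *\<^sub>R z ^ n) - (\<Sum>n<m. c n *\<^sub>R z ^ n)) \<le> 2 * c m / norm (1 - z)"
proof -
  have "(\<Sum>n. c n *\<^sub>R z ^ n) - (\<Sum>n<m. c n *\<^sub>R z ^ n) = (\<Sum>n. c (n + m) *\<^sub>R z ^ (n + m))"
    by (rule suminf_minus_initial_segment[symmetric, OF dirichlet_power_series(1)[OF assms]])
  also have "\<dots> = (\<Sum>n. z ^ m * (c (n + m) *\<^sub>R z ^ n))"
    by (simp add: power_add mult_ac)
  also have "\<dots> = z ^ m * (\<Sum>n. c (n + m) *\<^sub>R z ^ n)"
    using c by (intro suminf_mult dirichlet_power_series(1)[OF z] LIMSEQ_ignore_initial_segment)
               (auto simp: decseq_def)
  finally have "norm ((\<Sum>n. c n *\<^sub>R z ^ n) - (\<Sum>n<m. c n *\<^sub>R z ^ n)) = norm (\<Sum>n. c (n + m) *\<^sub>R z ^ n)"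
    using z by (simp add: norm_mult norm_power)
  also have "\<dots> \<le> 2 * c (0 + m) / norm (1 - z)"
    using c by (intro dirichlet_power_series(2)[OF z] LIMSEQ_ignore_initial_segment)
               (auto simp: decseq_def)
  finally show ?thesis by simp
qed

text \<open>The limit series need not converge absolutely, so the tail bound replaces domination: if
  \<open>b m\<close> is small, so is \<open>c t m\<close> eventually, and the finite head converges
  termwise.\<close>

lemma tendsto_dirichlet_power_series:
  fixes z :: complex and c :: "'a \<Rightarrow> nat \<Rightarrow> real" and b :: "nat \<Rightarrow> real"
  assumes z: "norm z = 1" "z \<noteq> 1" and b: "decseq b" "b \<longlonglongrightarrow> 0"
    and c: "\<forall>\<^sub>F t in F. decseq (c t) \<and> c t \<longlonglongrightarrow> 0"
    and lim: "\<And>n. ((\<lambda>t. c t n) \<longlongrightarrow> b n) F"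
  shows "((\<lambda>t. \<Sum>n. c t n *\<^sub>R z ^ n) \<longlongrightarrow> (\<Sum>n. b n *\<^sub>R z ^ n)) F"
proof (rule tendstoI)
  fix e :: real assume e: "e > 0"
  have D: "norm (1 - z) > 0" using z by simp
  \<comment> \<open>The 8 makes either tail less than \<open>2 * k / norm (1 - z) = e / 4\<close>;
    the heads contribute \<open>e / 2\<close>.\<close>
  define k where "k = e * norm (1 - z) / 8"
  have k: "k > 0" using e D by (simp add: k_def)
  then obtain m where m: "b m < k"
    using order_tendstoD(2)[OF b(2) k] by (auto simp: eventually_sequentially)
  have ev1: "\<forall>\<^sub>F t in F. c t m < k" using order_tendstoD(2)[OF lim m] .
  have "((\<lambda>t. \<Sum>n<m. c t n *\<^sub>R z ^ n) \<longlongrightarrow> (\<Sum>n<m. b n *\<^sub>R z ^ n)) F"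
    by (intro tendsto_intros lim)
  then have ev2: "\<forall>\<^sub>F t in F. dist (\<Sum>n<m. c t n *\<^sub>R z ^ n) (\<Sum>n<m. b n *\<^sub>R z ^ n) < e / 2"
    using e by (intro tendstoD) auto
  show "\<forall>\<^sub>F t in F. dist (\<Sum>n. c t n *\<^sub>R z ^ n) (\<Sum>n. b n *\<^sub>R z ^ n) < e"
    using c ev1 ev2
  proof eventually_elim
    case (elim t)
    have "norm ((\<Sum>n. c t n *\<^sub>R z ^ n) - (\<Sum>n<m. c t n *\<^sub>R z ^ n)) \<le> 2 * c t m / norm (1 - z)"
      using elim by (intro dirichlet_power_series_tail z) auto
    also have "\<dots> < 2 * k / norm (1 - z)" using elim D by (intro divide_strict_right_mono) auto
    also have "\<dots> = e / 4" using D by (simp add: k_def)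
    finally have 1: "norm ((\<Sum>n. c t n *\<^sub>R z ^ n) - (\<Sum>n<m. c t n *\<^sub>R z ^ n)) < e / 4" .
    have "norm ((\<Sum>n. b n *\<^sub>R z ^ n) - (\<Sum>n<m. b n *\<^sub>R z ^ n)) \<le> 2 * b m / norm (1 - z)"
      by (intro dirichlet_power_series_tail z b)
    also have "\<dots> < 2 * k / norm (1 - z)" using m D by (intro divide_strict_right_mono) auto
    also have "\<dots> = e / 4" using D by (simp add: k_def)
    finally have 2: "norm ((\<Sum>n. b n *\<^sub>R z ^ n) - (\<Sum>n<m. b n *\<^sub>R z ^ n)) < e / 4" .
    show ?case using 1 2 elim(3) by (simp only: dist_norm) norm
  qed
qed

text \<open>Abel's limit argument: inside the disc the logarithm series is available at
  \<open>r * z\<close>, and both sides converge as \<open>r\<close> tends to 1 from below. The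
  division by \<open>z\<close> accounts for the shift from \<open>z ^ Suc n\<close> to
  \<open>z ^ n\<close>.\<close>

lemma suminf_power_div_Suc_unit_circle:
  fixes z :: complex
  assumes z: "norm z = 1" "z \<noteq> 1"
  shows "(\<Sum>n. (1 / real (Suc n)) *\<^sub>R z ^ n) = - Ln (1 - z) / z"
proof (rule tendsto_unique[of "at_left (1::real)"])
  show "((\<lambda>r. \<Sum>n. (r ^ Suc n / real (Suc n)) *\<^sub>R z ^ n) \<longlongrightarrow> (\<Sum>n. (1 / real (Suc n)) *\<^sub>R z ^ n)) (at_left 1)"
  proof (rule tendsto_dirichlet_power_series[OF z])
    show "decseq (\<lambda>n. 1 / real (Suc n))" by (intro decseq_SucI) (auto simp: field_simps)
    show "(\<lambda>n. 1 / real (Suc n)) \<longlonglongrightarrow> 0" using LIMSEQ_inverse_real_of_nat by (simp add: inverse_eq_divide)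
    have "\<forall>\<^sub>F r in at_left (1::real). r \<in> {0<..<1}" by (rule eventually_at_leftI[of 0]) auto
    then show "\<forall>\<^sub>F r in at_left (1::real). decseq (\<lambda>n. r ^ Suc n / real (Suc n)) \<and> (\<lambda>n. r ^ Suc n / real (Suc n)) \<longlonglongrightarrow> 0"
    proof eventually_elim
      case (elim r)
      have "decseq (\<lambda>n. r ^ Suc n / real (Suc n))"
        using elim by (intro decseq_SucI frac_le power_decreasing) (auto simp del: power_Suc)
      moreover have "(\<lambda>n. r ^ Suc n * (1 / real (Suc n))) \<longlonglongrightarrow> 0 * 0"
      proof (rule tendsto_mult)
        show "(\<lambda>n. r ^ Suc n) \<longlonglongrightarrow> 0"
          using elim by (intro LIMSEQ_Suc LIMSEQ_power_zero) auto
        show "(\<lambda>n. 1 / real (Suc n)) \<longlonglongrightarrow> 0"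
          using LIMSEQ_inverse_real_of_nat by (simp add: inverse_eq_divide)
      qed
      ultimately show ?case by simp
    qed
    show "((\<lambda>r. r ^ Suc n / real (Suc n)) \<longlongrightarrow> 1 / real (Suc n)) (at_left 1)" for n
      by (rule tendsto_eq_intros refl | simp)+
  qed
  \<comment> \<open>\<open>1 - z\<close> avoids the branch cut of \<open>Ln\<close>: on the unit
    circle \<open>Re z \<ge> 1\<close> forces \<open>z = 1\<close>.\<close>
  have nonpos: "1 - z \<notin> \<real>\<^sub>\<le>\<^sub>0"
  proof
    assume "1 - z \<in> \<real>\<^sub>\<le>\<^sub>0"
    then have "Re z \<ge> 1" "Im z = 0" by (auto simp: complex_nonpos_Reals_iff)
    moreover have "Re z \<le> 1" using z(1) complex_Re_le_cmod[of z] by simp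
    ultimately show False using z by (auto simp: complex_eq_iff)
  qed
  have "((\<lambda>r. - Ln (1 - of_real r * z) / z) \<longlongrightarrow> - Ln (1 - of_real 1 * z) / z) (at_left 1)"
    using z nonpos by (intro tendsto_intros) auto
  moreover have "\<forall>\<^sub>F r in at_left (1::real). r \<in> {0<..<1}" by (rule eventually_at_leftI[of 0]) auto
  then have "\<forall>\<^sub>F r in at_left (1::real). - Ln (1 - of_real r * z) / z = (\<Sum>n. (r ^ Suc n / real (Suc n)) *\<^sub>R z ^ n)"
  proof eventually_elim
    case (elim r)
    have nz: "z \<noteq> 0" using z by auto
    \<comment> \<open>Division by zero gives \<open>f 0 = 0\<close>, so dropping the term at 0
      leaves the sum unchanged.\<close>
    define f where "f n = - ((of_real r * z) ^ n / of_nat n)" for n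
    have "(\<lambda>n. - ((- (- (of_real r * z))) ^ n) / of_nat n) sums ln (1 + - (of_real r * z))"
      using elim z by (intro Ln_series') (simp add: norm_mult)
    then have "f sums ln (1 - of_real r * z)"
      by (simp add: f_def[abs_def])
    then have "(\<lambda>n. f (Suc n)) sums ln (1 - of_real r * z)"
      by (subst sums_Suc_iff) (simp add: f_def)
    from sums_divide[OF sums_minus[OF this], of z]
    have "(\<lambda>n. (of_real r * z) ^ Suc n / of_nat (Suc n) / z) sums (- ln (1 - of_real r * z) / z)"
      unfolding f_def minus_minus .
    also have "(\<lambda>n. (of_real r * z) ^ Suc n / of_nat (Suc n) / z) = (\<lambda>n. (r ^ Suc n / real (Suc n)) *\<^sub>R z ^ n)"
      using nz by (auto simp: fun_eq_iff scaleR_conv_of_real power_mult_distrib simp del: of_nat_Suc)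
    finally show ?case by (simp add: sums_iff)
  qed
  ultimately have "((\<lambda>r. \<Sum>n. (r ^ Suc n / real (Suc n)) *\<^sub>R z ^ n) \<longlongrightarrow> - Ln (1 - of_real 1 * z) / z) (at_left 1)"
    by (rule Lim_transform_eventually)
  then show "((\<lambda>r. \<Sum>n. (r ^ Suc n / real (Suc n)) *\<^sub>R z ^ n) \<longlongrightarrow> - Ln (1 - z) / z) (at_left 1)"
    by simp
qed simp

section \<open>The complementary error function\<close>

text \<open>With a compact interval, differentiation is the fundamental theorem of calculus; the
  decay at infinity then is the normalisation of the Gaussian. For negative \<open>s\<close> the
  interval is empty and the value is 1.\<close>

definition erfc :: "real \<Rightarrow> real" where
  "erfc s = 1 - 2 / sqrt pi * integral {0..s} (\<lambda>r. exp (- r\<^sup>2))"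

lemma DERIV_erfc:
  assumes "s > 0"
  shows "DERIV erfc s :> - (2 / sqrt pi) * exp (- s\<^sup>2)"
proof -
  have "((\<lambda>u. integral {0..u} (\<lambda>r::real. exp (- r\<^sup>2))) has_real_derivative exp (- s\<^sup>2)) (at s within {0..s + 1})"
    using assms by (intro integral_has_real_derivative continuous_intros) auto
  then have "DERIV (\<lambda>u. integral {0..u} (\<lambda>r::real. exp (- r\<^sup>2))) s :> exp (- s\<^sup>2)"
    using assms by (simp add: at_within_Icc_at)
  from DERIV_diff[OF DERIV_const[of 1] DERIV_cmult[OF this, of "2 / sqrt pi"]] show ?thesis
    unfolding erfc_def[abs_def] by simp
qed

lemma tendsto_erfc_0: "(erfc \<longlongrightarrow> 1) (at_right 0)"
proof -
  have "continuous_on {0..1} (\<lambda>u. integral {0..u} (\<lambda>r::real. exp (- r\<^sup>2)))"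
    by (intro indefinite_integral_continuous_1 integrable_continuous_real continuous_intros)
  then have "((\<lambda>u. integral {0..u} (\<lambda>r::real. exp (- r\<^sup>2))) \<longlongrightarrow> 0) (at_right 0)"
    by (auto simp: continuous_on_def at_within_Icc_at_right dest!: bspec[where x = 0])
  then have "((\<lambda>u. 1 - 2 / sqrt pi * integral {0..u} (\<lambda>r::real. exp (- r\<^sup>2))) \<longlongrightarrow> 1 - 2 / sqrt pi * 0) (at_right 0)"
    by (intro tendsto_intros)
  then show ?thesis by (simp add: erfc_def[abs_def])
qed

lemma tendsto_erfc_at_top: "(erfc \<longlongrightarrow> 0) at_top"
proof -
  let ?g = "\<lambda>x::real. indicator {0..} x *\<^sub>R exp (- x\<^sup>2)"
  have g: "integrable lborel ?g" "(LINT x|lborel. ?g x) = sqrt pi / 2"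
    using gaussian_moment_0 by (auto simp: has_bochner_integral_iff)
  have "((\<lambda>y. LINT x|lborel. indicator {..y} x *\<^sub>R ?g x) \<longlongrightarrow> sqrt pi / 2) at_top"
    using tendsto_integral_at_top[OF sets_lborel g(1)] unfolding g(2) .
  also have "(\<lambda>y. LINT x|lborel. indicator {..y} x *\<^sub>R ?g x) = (\<lambda>y. integral {0..y} (\<lambda>r. exp (- r\<^sup>2)))"
  proof
    fix y :: real
    have "(LINT x|lborel. indicator {..y} x *\<^sub>R ?g x) = (LINT x:{0..y}|lborel. exp (- x\<^sup>2))"
      unfolding set_lebesgue_integral_def by (intro Bochner_Integration.integral_cong) (auto simp: indicator_def)
    also have "\<dots> = integral {0..y} (\<lambda>r. exp (- r\<^sup>2))"
      by (intro set_borel_integral_eq_integral borel_integrable_atLeastAtMost') (auto intro!: continuous_intros)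
    finally show "(LINT x|lborel. indicator {..y} x *\<^sub>R ?g x) = integral {0..y} (\<lambda>r. exp (- r\<^sup>2))" .
  qed
  finally have "((\<lambda>y. 1 - 2 / sqrt pi * integral {0..y} (\<lambda>r::real. exp (- r\<^sup>2))) \<longlongrightarrow> 1 - 2 / sqrt pi * (sqrt pi / 2)) at_top"
    by (intro tendsto_intros)
  then show ?thesis by (simp add: erfc_def[abs_def])
qed

lemma erfc_antimono:
  assumes "0 < s" "s \<le> u"
  shows "erfc u \<le> erfc s"
proof (rule DERIV_nonpos_imp_nonincreasing[OF assms(2)])
  fix x assume "s \<le> x" "x \<le> u"
  then show "\<exists>y. DERIV erfc x :> y \<and> y \<le> 0"
    using assms DERIV_erfc[of x] by (intro exI conjI) auto
qed

lemma erfc_nonneg: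
  assumes "0 < s"
  shows "0 \<le> erfc s"
  using tendsto_upperbound[OF tendsto_erfc_at_top, of "erfc s"] assms
  by (auto intro!: erfc_antimono eventually_mono[OF eventually_ge_at_top[of s]])

text \<open>The difference \<open>erfc s - 2 / s\<close> is nondecreasing and tends to 0 at
  infinity. The bound is crude, but after division by the frequency it is summable.\<close>

lemma erfc_le:
  assumes "0 < s"
  shows "erfc s \<le> 2 / s"
proof -
  have mono: "erfc u - 2 / u \<le> erfc v - 2 / v" if "0 < u" "u \<le> v" for u v
  proof (rule DERIV_nonneg_imp_nondecreasing[OF that(2)])
    fix x assume "u \<le> x" "x \<le> v"
    then have x: "x > 0" using that by auto
    have D: "DERIV (\<lambda>x. erfc x - 2 / x) x :> - (2 / sqrt pi) * exp (- x\<^sup>2) + 2 / x\<^sup>2"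
      using x by (auto intro!: derivative_eq_intros DERIV_erfc simp: power2_eq_square)
    have "x\<^sup>2 \<le> exp (x\<^sup>2)" using exp_ge_add_one_self[of "x\<^sup>2"] by linarith
    then have "exp (- x\<^sup>2) \<le> 1 / x\<^sup>2" using x by (simp add: exp_minus field_simps)
    moreover have "1 / sqrt pi \<le> 1" using pi_ge_two by simp
    ultimately have "(1 / sqrt pi) * exp (- x\<^sup>2) \<le> 1 * (1 / x\<^sup>2)"
      by (intro mult_mono) auto
    then show "\<exists>y. DERIV (\<lambda>x. erfc x - 2 / x) x :> y \<and> 0 \<le> y"
      using D by (intro exI conjI) auto
  qed
  have "((\<lambda>v. erfc v - 2 / v) \<longlongrightarrow> 0 - 0) at_top"
    by (intro tendsto_diff tendsto_erfc_at_top tendsto_divide_0[OF tendsto_const] filterlim_at_top_imp_at_infinity filterlim_ident)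
  then have "erfc s - 2 / s \<le> 0 - 0"
    using assms
    by (intro tendsto_lowerbound[of "\<lambda>v. erfc v - 2 / v"])
       (auto intro!: mono eventually_mono[OF eventually_ge_at_top[of s]])
  then show ?thesis by simp
qed

text \<open>The derivative is the Fourier integrand at frequency \<open>k\<close> and, up to the
  cosine factor, the term of that frequency in the dual theta series divided by
  \<open>t\<close>.\<close>

lemma DERIV_erfc_inverse_sqrt:
  assumes "t > 0" "k > 0"
  shows "DERIV (\<lambda>t. erfc (pi * k / sqrt t) / k) t :> sqrt pi / (t * sqrt t) * exp (- (pi\<^sup>2 * k\<^sup>2 / t))"
proof -
  have D: "DERIV (\<lambda>t. pi * k / sqrt t) t :> - (pi * k) / (2 * (t * sqrt t))"
    using assms by (auto intro!: derivative_eq_intros simp: field_simps)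
  have "DERIV (\<lambda>t. erfc (pi * k / sqrt t) / k) t :>
      (- (2 / sqrt pi) * exp (- (pi * k / sqrt t)\<^sup>2)) * (- (pi * k) / (2 * (t * sqrt t))) / k"
    using assms by (intro DERIV_cdivide DERIV_chain2[OF DERIV_erfc D]) auto
  also have "(- (2 / sqrt pi) * exp (- (pi * k / sqrt t)\<^sup>2)) * (- (pi * k) / (2 * (t * sqrt t))) / k
      = pi / sqrt pi / (t * sqrt t) * exp (- (pi\<^sup>2 * k\<^sup>2 / t))"
    using assms by (simp add: power_divide power_mult_distrib)
  finally show ?thesis by (simp add: real_div_sqrt)
qed

lemma powr_three_halves: "t > 0 \<Longrightarrow> t powr (3 / 2) = t * sqrt (t::real)"
  using powr_add[of t 1 "1/2"] by (simp add: powr_half_sqrt)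

lemma filterlim_const_div_sqrt_at_right_0:
  assumes "c > 0"
  shows "filterlim (\<lambda>t. c / sqrt t) at_top (at_right 0)"
proof (rule LIM_at_top_divide)
  show "(sqrt \<longlongrightarrow> 0) (at_right 0)"
    by (rule tendsto_eq_intros refl | simp)+
qed (use assms in \<open>auto simp: eventually_at_filter\<close>)

text \<open>The antiderivative \<open>erfc (pi * k / sqrt t) / k\<close> vanishes as
  \<open>t\<close> tends to 0 from the right, since its argument tends to infinity.\<close>

lemma fourier_part_integral:
  assumes "k > 0"
  shows "(LINT t:{0<..1}|lborel. pi powr (1/2) / t powr (3/2) * exp (- (pi\<^sup>2 * k\<^sup>2 / t))) = erfc (pi * k) / k"
proof -
  let ?f = "\<lambda>t. pi powr (1/2) / t powr (3/2) * exp (- (pi\<^sup>2 * k\<^sup>2 / t))"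
  let ?F = "\<lambda>t. erfc (pi * k / sqrt t) / k"
  have D: "DERIV ?F t :> ?f t" if "t > 0" for t
    using DERIV_erfc_inverse_sqrt[OF that assms] that by (simp add: powr_half_sqrt powr_three_halves)
  have "(LBINT t=ereal 0..ereal 1. ?f t) = ?F 1 - 0"
  proof (rule interval_integral_FTC_nonneg(2))
    show "((?F \<circ> real_of_ereal) \<longlongrightarrow> 0) (at_right (ereal 0))"
    proof -
      have "(?F \<longlongrightarrow> 0 / k) (at_right 0)"
        using assms by (intro tendsto_divide filterlim_compose[OF tendsto_erfc_at_top] filterlim_const_div_sqrt_at_right_0) auto
      then show ?thesis by (simp add: ereal_tendsto_simps)
    qed
    show "((?F \<circ> real_of_ereal) \<longlongrightarrow> ?F 1) (at_left (ereal 1))"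
    proof -
      have "isCont ?F 1" using D[of 1] by (auto intro: DERIV_isCont)
      then show ?thesis by (simp add: ereal_tendsto_simps isCont_def filterlim_at_split)
    qed
  qed (use D in \<open>auto intro!: continuous_intros\<close>)
  then show ?thesis by (simp add: interval_integral_Ioc)
qed

section \<open>Poisson summation for Gaussians\<close>

lemma integral_sums_uniform:
  fixes f :: "nat \<Rightarrow> real \<Rightarrow> complex"
  assumes cont: "\<And>n. continuous_on {a..b} (f n)"
    and bound: "\<And>n x. x \<in> {a..b} \<Longrightarrow> norm (f n x) \<le> M n" and M: "summable M"
  shows "(\<lambda>n. integral {a..b} (f n)) sums integral {a..b} (\<lambda>x. \<Sum>n. f n x)"
proof -
  have int: "f n integrable_on {a..b}" for n
    by (intro integrable_continuous_real cont)
  have "uniform_limit {a..b} (\<lambda>n x. \<Sum>i<n. f i x) (\<lambda>x. \<Sum>n. f n x) sequentially"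
    by (rule Weierstrass_m_test[OF bound M])
  then obtain I J where I: "\<And>n. ((\<lambda>x. \<Sum>i<n. f i x) has_integral I n) {a..b}"
      and J: "((\<lambda>x. \<Sum>n. f n x) has_integral J) {a..b}" and lim: "I \<longlonglongrightarrow> J"
    by (rule uniform_limit_integral) (auto intro!: continuous_intros cont)
  have "I = (\<lambda>n. \<Sum>i<n. integral {a..b} (f i))"
  proof
    fix n
    have "((\<lambda>x. \<Sum>i<n. f i x) has_integral (\<Sum>i<n. integral {a..b} (f i))) {a..b}"
      by (intro has_integral_sum integrable_integral int) auto
    then show "I n = (\<Sum>i<n. integral {a..b} (f i))"
      using I has_integral_unique by blast
  qed
  then show ?thesis
    using lim integral_unique[OF J] by (simp add: sums_def)
qed

section \<open>Orthogonality of exponentials and the Fourier transform of the Gaussian\<close>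

lemma integral_cis_int:
  fixes m :: int
  shows "integral {0..1} (\<lambda>x. cis (2 * pi * of_int m * x)) = (if m = 0 then 1 else 0)"
proof (cases "m = 0")
  case False
  define k where "k = 2 * pi * of_int m"
  have k: "k \<noteq> 0" using False by (simp add: k_def)
  have "((\<lambda>x. cis (k * x)) has_integral cis (k * 1) / (\<i> * k) - cis (k * 0) / (\<i> * k)) {0..1}"
  proof (rule fundamental_theorem_of_calculus)
    fix x :: real
    have "((\<lambda>x. cis (k * x)) has_vector_derivative k *\<^sub>R (\<i> * cis (k * x))) (at x within {0..1})"
      unfolding cis_conv_exp of_real_mult
      by (rule has_vector_derivative_real_field)
         (auto intro!: derivative_eq_intros simp: scaleR_conv_of_real)
    from has_vector_derivative_divide[OF this, of "\<i> * k"]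
    show "((\<lambda>x. cis (k * x) / (\<i> * k)) has_vector_derivative cis (k * x)) (at x within {0..1})"
      using k by (simp add: scaleR_conv_of_real)
  qed simp
  moreover have "cis k = 1" using cis_multiple_2pi[of m] by (simp add: k_def)
  ultimately show ?thesis using False by (simp add: integral_unique k_def)
qed simp

lemma integral_cos_cis_int:
  fixes m :: int and k :: nat
  assumes "k > 0"
  shows "integral {0..1} (\<lambda>x. of_real (cos (2 * pi * real k * x)) * cis (2 * pi * of_int m * x))
    = (if \<bar>m\<bar> = int k then 1 / 2 else 0)"
proof -
  have "of_real (cos (2 * pi * real k * x)) * cis (2 * pi * of_int m * x)
      = (cis (2 * pi * of_int (m + int k) * x) + cis (2 * pi * of_int (m - int k) * x)) / 2" for x
  proof -
    have "cis (2 * pi * of_int (m + int k) * x) = cis (2 * pi * real k * x) * cis (2 * pi * of_int m * x)"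
      by (simp add: cis_mult algebra_simps)
    moreover have "cis (2 * pi * of_int (m - int k) * x) = cis (- (2 * pi * real k * x)) * cis (2 * pi * of_int m * x)"
      by (simp add: cis_mult algebra_simps)
    moreover have "complex_of_real (cos y) = (cis y + cis (- y)) / 2" for y
      by (simp add: complex_eq_iff)
    ultimately show ?thesis by (simp only: distrib_right times_divide_eq_left)
  qed
  moreover have "integral {0..1} (\<lambda>x. (cis (2 * pi * of_int (m + int k) * x) + cis (2 * pi * of_int (m - int k) * x)) / 2)
      = ((if m + int k = 0 then 1 else 0) + (if m - int k = 0 then 1 else 0)) / 2"
    unfolding integral_divide
    by (subst integral_add)
       (auto intro!: integrable_continuous_real continuous_intros simp: integral_cis_int simp del: of_int_add of_int_diff)
  ultimately show ?thesis
    using assms by (simp only:) auto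
qed

text \<open>A rescaling of the characteristic function of the standard normal distribution.\<close>

lemma gaussian_fourier_transform:
  fixes t \<xi> :: real
  assumes t: "t > 0"
  shows "integrable lborel (\<lambda>x. of_real (exp (- x\<^sup>2 * t)) * cis (2 * pi * \<xi> * x))"
    and "(CLINT x|lborel. of_real (exp (- x\<^sup>2 * t)) * cis (2 * pi * \<xi> * x))
          = of_real (sqrt (pi / t) * exp (- (pi\<^sup>2 * \<xi>\<^sup>2 / t)))"
proof -
  \<comment> \<open>\<open>c\<close> turns the exponent \<open>(c * x)^2 / 2\<close> of the density
    into \<open>x^2 * t\<close>, and \<open>s\<close> makes the phase \<open>s * (c * x)\<close>
    equal to \<open>2 * pi * \<xi> * x\<close>.\<close>
  define c where "c = sqrt (2 * t)"
  have c: "c > 0" "c\<^sup>2 = 2 * t" using t by (auto simp: c_def)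
  define s where "s = 2 * pi * \<xi> / c"
  let ?g = "\<lambda>x. std_normal_density x *\<^sub>R iexp (s * x)"
  have dens: "std_normal_density (c * x) = (1 / sqrt (2 * pi)) * exp (- x\<^sup>2 * t)" for x
    by (simp add: std_normal_density_def power_mult_distrib c algebra_simps)
  have g: "?g (0 + c * x) = of_real (1 / sqrt (2 * pi)) * (of_real (exp (- x\<^sup>2 * t)) * cis (2 * pi * \<xi> * x))" for x
  proof -
    have "s * (c * x) = 2 * pi * \<xi> * x" using c by (simp add: s_def)
    then have "iexp (s * (0 + c * x)) = cis (2 * pi * \<xi> * x)"
      by (simp only: cis_conv_exp add_0)
    then show ?thesis
      by (simp only: dens scaleR_conv_of_real add_0 of_real_mult mult.assoc)
  qed
  have int_g: "integrable lborel ?g"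
  proof (rule Bochner_Integration.integrable_bound)
    show "integrable lborel std_normal_density" by simp
  qed auto
  have "integrable lborel (\<lambda>x. ?g (0 + c * x))"
    using c by (intro lborel_integrable_real_affine int_g) auto
  then have "integrable lborel (\<lambda>x. of_real (sqrt (2 * pi)) * ?g (0 + c * x))"
    by (rule integrable_mult_right)
  then show "integrable lborel (\<lambda>x. of_real (exp (- x\<^sup>2 * t)) * cis (2 * pi * \<xi> * x))"
    unfolding g by simp
  have "complex_of_real (exp (- s\<^sup>2 / 2)) = (CLINT x|lborel. ?g x)"
    using fun_cong[OF char_std_normal_distribution, of s]
    unfolding char_def by (subst (asm) integral_density) auto
  also have "\<dots> = c *\<^sub>R (CLINT x|lborel. ?g (0 + c * x))"
    using lborel_integral_real_affine[of c ?g 0] c by simp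
  also have "\<dots> = of_real (c / sqrt (2 * pi)) * (CLINT x|lborel. of_real (exp (- x\<^sup>2 * t)) * cis (2 * pi * \<xi> * x))"
    unfolding g by (simp add: scaleR_conv_of_real)
  finally have eq: "complex_of_real (exp (- s\<^sup>2 / 2)) = of_real (c / sqrt (2 * pi)) *
      (CLINT x|lborel. of_real (exp (- x\<^sup>2 * t)) * cis (2 * pi * \<xi> * x))" .
  have "c / sqrt (2 * pi) = sqrt (t / pi)"
    by (simp add: c_def real_sqrt_divide real_sqrt_mult)
  moreover have "s\<^sup>2 / 2 = pi\<^sup>2 * \<xi>\<^sup>2 / t"
    using t by (simp add: s_def power_divide c power_mult_distrib)
  ultimately have eq': "complex_of_real (exp (- (pi\<^sup>2 * \<xi>\<^sup>2 / t))) = of_real (sqrt (t / pi)) *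
      (CLINT x|lborel. of_real (exp (- x\<^sup>2 * t)) * cis (2 * pi * \<xi> * x))"
    using eq by simp
  have "sqrt (pi / t) * sqrt (t / pi) = 1"
    using t by (simp add: real_sqrt_divide)
  then have "complex_of_real (sqrt (pi / t)) * of_real (sqrt (t / pi)) = 1"
    by (simp flip: of_real_mult)
  then show "(CLINT x|lborel. of_real (exp (- x\<^sup>2 * t)) * cis (2 * pi * \<xi> * x))
      = of_real (sqrt (pi / t) * exp (- (pi\<^sup>2 * \<xi>\<^sup>2 / t)))"
    by (simp only: of_real_mult eq' mult.assoc[symmetric] mult_1)
qed

section \<open>The theta function and its Fourier coefficients\<close>

text \<open>The terms \<open>v = n\<close> and \<open>v = - n - 1\<close> of the sum of \<open>exp (- (x + v)\<^sup>2 * t)\<close> over all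
  integers \<open>v\<close> are paired, so that the sum runs over the natural numbers.\<close>

definition gauss_pair :: "real \<Rightarrow> nat \<Rightarrow> real \<Rightarrow> real" where
  "gauss_pair t n x = exp (- (x + real n)\<^sup>2 * t) + exp (- (x - 1 - real n)\<^sup>2 * t)"

definition theta :: "real \<Rightarrow> real \<Rightarrow> real" where
  "theta t x = (\<Sum>n. gauss_pair t n x)"

lemma gauss_pair_nonneg: "0 \<le> gauss_pair t n x"
  by (simp add: gauss_pair_def)

text \<open>For \<open>x\<close> in the unit interval both centres are at distance at least
  \<open>n\<close>, and \<open>n^2 \<ge> n\<close> relaxes the Gaussian decay to a geometric
  majorant uniform in \<open>x\<close>.\<close>

lemma gauss_pair_le:
  assumes "t > 0" "x \<in> {0..1}"
  shows "gauss_pair t n x \<le> 2 * exp (- t) ^ n"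
proof -
  have le: "exp (- y\<^sup>2 * t) \<le> exp (- t) ^ n" if "real n \<le> \<bar>y\<bar>" for y
  proof -
    have "real n \<le> real n * real n" by (cases n) auto
    also have "\<dots> \<le> \<bar>y\<bar> * \<bar>y\<bar>" using that by (intro mult_mono) auto
    finally have "real n * t \<le> y\<^sup>2 * t" using assms by (simp add: power2_eq_square)
    then show ?thesis by (simp flip: exp_of_nat_mult)
  qed
  have "exp (- (x + real n)\<^sup>2 * t) \<le> exp (- t) ^ n" "exp (- (x - 1 - real n)\<^sup>2 * t) \<le> exp (- t) ^ n"
    using assms by (intro le; auto)+
  then show ?thesis by (simp add: gauss_pair_def)
qed

lemma summable_exp_minus_power:
  assumes "(t::real) > 0"
  shows "summable (\<lambda>n. c * exp (- t) ^ n)"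
  using assms by (intro summable_mult summable_geometric) auto

lemma gauss_pair_summable:
  assumes "t > 0" "x \<in> {0..1}"
  shows "summable (\<lambda>n. gauss_pair t n x)"
  by (rule summable_comparison_test'[OF summable_exp_minus_power[OF assms(1), of 2]])
     (use gauss_pair_le[OF assms] gauss_pair_nonneg in auto)

lemma theta_continuous:
  assumes "t > 0"
  shows "continuous_on {0..1} (theta t)"
  unfolding theta_def[abs_def]
proof (rule uniform_limit_theorem)
  show "uniform_limit {0..1} (\<lambda>n x. \<Sum>i<n. gauss_pair t i x) (\<lambda>x. \<Sum>n. gauss_pair t n x) sequentially"
    by (rule Weierstrass_m_test[OF _ summable_exp_minus_power[OF assms, of 2]])
       (use gauss_pair_le[OF assms] gauss_pair_nonneg in auto)
  show "\<forall>\<^sub>F n in sequentially. continuous_on {0..1} (\<lambda>x. \<Sum>i<n. gauss_pair t i x)"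
    unfolding gauss_pair_def by (intro always_eventually allI continuous_intros)
qed simp

text \<open>Holds term by term: moving from 0 to 1 swaps the two exponentials of a pair.\<close>

lemma theta_0_eq_theta_1: "theta t 0 = theta t 1"
proof -
  have "gauss_pair t n 0 = gauss_pair t n 1" for n
    by (simp add: gauss_pair_def power2_commute[of 0 1] power2_eq_square algebra_simps)
  then show ?thesis by (simp add: theta_def)
qed

text \<open>Unfolding: the exponential has period 1, so integrating all translates over one period
  integrates the Gaussian over the line. Pair \<open>n\<close> covers the unit intervals starting at
  \<open>n\<close> and at \<open>- n - 1\<close>; the first \<open>N\<close> pairs fill
  \<open>{- real N..real N}\<close>.\<close>

lemma theta_fourier_coefficient:
  fixes w :: int
  assumes t: "t > 0"
  shows "integral {0..1} (\<lambda>x. of_real (theta t x) * cis (2 * pi * of_int w * x))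
    = of_real (sqrt (pi / t) * exp (- (pi\<^sup>2 * (of_int w)\<^sup>2 / t)))"
proof -
  let ?e = "\<lambda>x. cis (2 * pi * of_int w * x)"
  define g where "g x = of_real (exp (- x\<^sup>2 * t)) * ?e x" for x
  have g_cont: "continuous_on A g" for A
    unfolding g_def by (intro continuous_intros)
  have g_int: "g integrable_on {a..b}" for a b
    by (intro integrable_continuous_real g_cont)
  have e_shift: "?e (x + of_int k) = ?e x" for x k
  proof -
    have "?e (x + of_int k) = ?e x * cis (2 * pi * of_int (w * k))"
      by (simp add: cis_mult algebra_simps)
    then show ?thesis using cis_multiple_2pi[of "of_int (w * k)"] by simp
  qed
  have g_shift: "integral {0..1} (\<lambda>x. of_real (exp (- (x + of_int k)\<^sup>2 * t)) * ?e x) = integral {of_int k..of_int k + 1} g" for k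
  proof -
    have "integral {0..1} (g \<circ> (\<lambda>x. x + of_int k)) = integral {0 + of_int k..1 + of_int k} g"
      by (intro integral_shift g_cont)
    then show ?thesis by (simp add: o_def g_def e_shift add.commute)
  qed
  have coeff: "integral {0..1} (\<lambda>x. of_real (gauss_pair t n x) * ?e x)
      = integral {real n..real (Suc n)} g + integral {- real (Suc n)..- real n} g" for n
  proof -
    have "integral {0..1} (\<lambda>x. of_real (gauss_pair t n x) * ?e x)
        = integral {0..1} (\<lambda>x. of_real (exp (- (x + of_int (int n))\<^sup>2 * t)) * ?e x
            + of_real (exp (- (x + of_int (- int n - 1))\<^sup>2 * t)) * ?e x)"
      by (simp add: gauss_pair_def algebra_simps)
    also have "\<dots> = integral {of_int (int n)..of_int (int n) + 1} g + integral {of_int (- int n - 1)..of_int (- int n - 1) + 1} g"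
      unfolding g_shift[symmetric]
      by (intro Henstock_Kurzweil_Integration.integral_add integrable_continuous_real continuous_intros)
    also have "real_of_int (int n) + 1 = real (Suc n)" by simp
    also have "real_of_int (- int n - 1) = - real (Suc n)" by simp
    also have "- real (Suc n) + 1 = - real n" by simp
    finally show ?thesis by simp
  qed
  have partial: "(\<Sum>n<N. integral {0..1} (\<lambda>x. of_real (gauss_pair t n x) * ?e x)) = integral {- real N..real N} g" for N
  proof (induction N)
    case (Suc N)
    have "integral {- real (Suc N)..real (Suc N)} g
        = integral {- real (Suc N)..- real N} g + integral {- real N..real (Suc N)} g"
      by (rule Henstock_Kurzweil_Integration.integral_combine[symmetric]) (auto simp: g_int)
    also have "integral {- real N..real (Suc N)} g = integral {- real N..real N} g + integral {real N..real (Suc N)} g"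
      by (rule Henstock_Kurzweil_Integration.integral_combine[symmetric]) (auto simp: g_int)
    finally show ?case
      using Suc unfolding sum.lessThan_Suc coeff by (simp add: algebra_simps)
  qed simp
  have "(\<lambda>N. integral {- real N..real N} g) \<longlonglongrightarrow> (CLINT x|lborel. g x)"
  proof -
    have int: "integrable lborel g"
      unfolding g_def[abs_def] by (rule gaussian_fourier_transform(1)[OF t])
    have "(\<lambda>N. CLINT x|lborel. indicator {- real N..real N} x *\<^sub>R g x) \<longlonglongrightarrow> (CLINT x|lborel. g x)"
    proof (rule integral_dominated_convergence)
      show "integrable lborel (\<lambda>x. norm (g x))" using int by (rule integrable_norm)
      show "AE x in lborel. (\<lambda>N. indicator {- real N..real N} x *\<^sub>R g x) \<longlonglongrightarrow> g x"
      proof (rule AE_I2)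
        fix x :: real
        obtain N0 where N0: "\<bar>x\<bar> \<le> real N0" using real_arch_simple by blast
        have "\<forall>\<^sub>F N in sequentially. indicator {- real N..real N} x *\<^sub>R g x = g x"
          using eventually_ge_at_top[of N0]
        proof eventually_elim
          case (elim N)
          then have "\<bar>x\<bar> \<le> real N" using N0 by linarith
          then show ?case by (auto simp: indicator_def)
        qed
        then show "(\<lambda>N. indicator {- real N..real N} x *\<^sub>R g x) \<longlonglongrightarrow> g x"
          by (rule tendsto_eventually)
      qed
    qed (use int in \<open>auto simp: indicator_def\<close>)
    also have "(\<lambda>N. CLINT x|lborel. indicator {- real N..real N} x *\<^sub>R g x) = (\<lambda>N. integral {- real N..real N} g)"
    proof
      fix N
      have "(CLINT x:{- real N..real N}|lborel. g x) = integral {- real N..real N} g"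
        by (intro set_borel_integral_eq_integral borel_integrable_atLeastAtMost' g_cont)
      then show "(CLINT x|lborel. indicator {- real N..real N} x *\<^sub>R g x) = integral {- real N..real N} g"
        by (simp add: set_lebesgue_integral_def)
    qed
    finally show ?thesis .
  qed
  then have "(\<lambda>n. integral {0..1} (\<lambda>x. of_real (gauss_pair t n x) * ?e x)) sums (CLINT x|lborel. g x)"
    unfolding sums_def partial .
  \<comment> \<open>The same series evaluated the other way, by exchanging the uniformly convergent
    sum with the integral; uniqueness of sums compares the two values.\<close>
  moreover have "(\<lambda>n. integral {0..1} (\<lambda>x. of_real (gauss_pair t n x) * ?e x)) sums
      integral {0..1} (\<lambda>x. \<Sum>n. of_real (gauss_pair t n x) * ?e x)"
  proof (rule integral_sums_uniform[OF _ _ summable_exp_minus_power[OF t, of 2]])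
    show "continuous_on {0..1} (\<lambda>x. of_real (gauss_pair t n x) * ?e x)" for n
      unfolding gauss_pair_def by (intro continuous_intros)
    show "norm (of_real (gauss_pair t n x) * ?e x) \<le> 2 * exp (- t) ^ n" if "x \<in> {0..1}" for n x
      using gauss_pair_le[OF t that] gauss_pair_nonneg[of t n x] by (simp add: norm_mult)
  qed
  ultimately have "integral {0..1} (\<lambda>x. \<Sum>n. of_real (gauss_pair t n x) * ?e x) = (CLINT x|lborel. g x)"
    using sums_unique2 by blast
  moreover have "integral {0..1} (\<lambda>x. \<Sum>n. of_real (gauss_pair t n x) * ?e x)
      = integral {0..1} (\<lambda>x. of_real (theta t x) * ?e x)"
  proof (rule integral_cong)
    fix x :: real assume x: "x \<in> {0..1}"
    from sums_mult2[OF sums_of_real[OF summable_sums[OF gauss_pair_summable[OF t x]]]]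
    have "(\<lambda>n. of_real (gauss_pair t n x) * ?e x) sums (of_real (theta t x) * ?e x)"
      unfolding theta_def .
    then show "(\<Sum>n. of_real (gauss_pair t n x) * ?e x) = of_real (theta t x) * ?e x"
      by (rule sums_unique[symmetric])
  qed
  ultimately show ?thesis
    using gaussian_fourier_transform(2)[OF t, of "of_int w"] by (simp add: g_def[abs_def])
qed

text \<open>A geometric majorant for the dual series, from \<open>(n + 1)^2 \<ge> n\<close> and
  \<open>pi \<ge> 1\<close>. Its ratio increases with \<open>t\<close>, so it also serves on bounded
  ranges of \<open>t\<close>.\<close>

lemma gauss_dual_le:
  assumes "t > 0"
  shows "exp (- (pi\<^sup>2 * (real (Suc n))\<^sup>2 / t)) \<le> exp (- (1 / t)) ^ n"
proof -
  have "real n \<le> 1 * (real (Suc n))\<^sup>2" by (simp add: power2_eq_square algebra_simps)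
  also have "\<dots> \<le> pi\<^sup>2 * (real (Suc n))\<^sup>2"
    using pi_ge_two by (intro mult_right_mono) (auto simp: power2_eq_square intro: mult_mono[of 1 pi 1 pi, simplified])
  finally have "real n / t \<le> pi\<^sup>2 * (real (Suc n))\<^sup>2 / t" using assms by (intro divide_right_mono) auto
  then have "exp (- (pi\<^sup>2 * (real (Suc n))\<^sup>2 / t)) \<le> exp (real n * - (1 / t))" by simp
  then show ?thesis by (simp only: exp_of_nat_mult)
qed

text \<open>Both sides are continuous, each takes equal values at 0 and 1, and their Fourier
  coefficients coincide, so \<open>fourier_uniqueness\<close> applies. Each cosine splits its
  coefficient 2 evenly between the frequencies of either sign.\<close>

theorem theta_poisson:
  assumes t: "t > 0" and x: "x \<in> {0..1}"
  shows "theta t x = sqrt (pi / t) *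
    (1 + (\<Sum>n. 2 * cos (2 * pi * real (Suc n) * x) * exp (- (pi\<^sup>2 * (real (Suc n))\<^sup>2 / t))))"
proof -
  define a where "a n = exp (- (pi\<^sup>2 * (real (Suc n))\<^sup>2 / t))" for n
  define u where "u n x = 2 * cos (2 * pi * real (Suc n) * x) * a n" for n x
  define S where "S x = (\<Sum>n. u n x)" for x
  have bound: "norm (u n x) \<le> 2 * exp (- (1 / t)) ^ n" for n x
  proof -
    have "norm (u n x) = 2 * \<bar>cos (2 * pi * real (Suc n) * x)\<bar> * a n"
      by (simp add: u_def a_def abs_mult)
    also have "\<dots> \<le> 2 * 1 * exp (- (1 / t)) ^ n"
      using gauss_dual_le[OF t, of n] by (intro mult_mono) (auto simp: a_def)
    finally show ?thesis by simp
  qed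
  have M: "summable (\<lambda>n. 2 * exp (- (1 / t)) ^ n)"
    using t by (intro summable_exp_minus_power) auto
  have u_summable: "summable (\<lambda>n. u n x)" for x
    by (rule summable_comparison_test'[OF M]) (rule bound)
  have S_cont: "continuous_on {0..1} S"
    unfolding S_def[abs_def]
  proof (rule uniform_limit_theorem)
    show "uniform_limit {0..1} (\<lambda>n x. \<Sum>i<n. u i x) (\<lambda>x. \<Sum>n. u n x) sequentially"
      by (rule Weierstrass_m_test[OF bound M])
    show "\<forall>\<^sub>F n in sequentially. continuous_on {0..1} (\<lambda>x. \<Sum>i<n. u i x)"
      unfolding u_def by (intro always_eventually allI continuous_intros)
  qed simp
  have S_coeff: "integral {0..1} (\<lambda>x. of_real (S x) * cis (2 * pi * of_int w * x))
      = of_real (if w = 0 then 0 else exp (- (pi\<^sup>2 * (of_int w)\<^sup>2 / t)))" for w :: int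
  proof -
    let ?e = "\<lambda>x. cis (2 * pi * of_int w * x)"
    have "(\<lambda>n. integral {0..1} (\<lambda>x. of_real (u n x) * ?e x)) sums
        integral {0..1} (\<lambda>x. \<Sum>n. of_real (u n x) * ?e x)"
    proof (rule integral_sums_uniform[OF _ _ M])
      show "continuous_on {0..1} (\<lambda>x. of_real (u n x) * ?e x)" for n
        unfolding u_def by (intro continuous_intros)
      show "norm (of_real (u n x) * ?e x) \<le> 2 * exp (- (1 / t)) ^ n" for n x
        using bound[of n x] by (simp add: norm_mult)
    qed
    also have "(\<lambda>x. \<Sum>n. of_real (u n x) * ?e x) = (\<lambda>x. of_real (S x) * ?e x)"
    proof
      fix x
      from sums_mult2[OF sums_of_real[OF summable_sums[OF u_summable[of x]]]]
      show "(\<Sum>n. of_real (u n x) * ?e x) = of_real (S x) * ?e x"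
        unfolding S_def by (rule sums_unique[symmetric])
    qed
    \<comment> \<open>Only the index \<open>\<bar>w\<bar> - 1\<close> survives. For
      \<open>w = 0\<close> truncation by \<open>nat\<close> points to index 0, where the value is
      set to 0.\<close>
    also have "(\<lambda>n. integral {0..1} (\<lambda>x. of_real (u n x) * ?e x))
        = (\<lambda>n. if n = nat (\<bar>w\<bar> - 1) then of_real (if w = 0 then 0 else exp (- (pi\<^sup>2 * (of_int w)\<^sup>2 / t))) else 0)"
    proof
      fix n
      have "integral {0..1} (\<lambda>x. of_real (u n x) * ?e x)
          = integral {0..1} (\<lambda>x. of_real (2 * a n) * (of_real (cos (2 * pi * real (Suc n) * x)) * ?e x))"
        by (simp add: u_def mult_ac)
      also have "\<dots> = of_real (2 * a n) * (if \<bar>w\<bar> = int (Suc n) then 1 / 2 else 0)"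
        unfolding integral_mult_right by (subst integral_cos_cis_int) auto
      also have "\<dots> = (if n = nat (\<bar>w\<bar> - 1) then of_real (if w = 0 then 0 else exp (- (pi\<^sup>2 * (of_int w)\<^sup>2 / t))) else 0)"
      proof (cases "\<bar>w\<bar> = int (Suc n)")
        case True
        then have "(real_of_int w)\<^sup>2 = (real (Suc n))\<^sup>2"
          by (metis of_int_abs of_int_of_nat_eq power2_abs)
        then show ?thesis using True by (auto simp: a_def)
      qed auto
      finally show "integral {0..1} (\<lambda>x. of_real (u n x) * ?e x)
          = (if n = nat (\<bar>w\<bar> - 1) then of_real (if w = 0 then 0 else exp (- (pi\<^sup>2 * (of_int w)\<^sup>2 / t))) else 0)" .
    qed
    finally have "(\<lambda>n. if n = nat (\<bar>w\<bar> - 1) then complex_of_real (if w = 0 then 0 else exp (- (pi\<^sup>2 * (of_int w)\<^sup>2 / t))) else 0)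
        sums integral {0..1} (\<lambda>x. of_real (S x) * ?e x)" .
    from sums_unique2[OF this sums_single] show ?thesis .
  qed
  have "theta t x - sqrt (pi / t) * (1 + S x) = 0"
  proof (rule fourier_uniqueness[OF _ _ _ x])
    show "continuous_on {0..1} (\<lambda>x. theta t x - sqrt (pi / t) * (1 + S x))"
      by (intro continuous_intros theta_continuous t S_cont)
    have "u n 0 = u n 1" for n
      using cos_int_2pin[of "int (Suc n)"] by (simp add: u_def mult_ac)
    then show "theta t 0 - sqrt (pi / t) * (1 + S 0) = theta t 1 - sqrt (pi / t) * (1 + S 1)"
      by (simp add: theta_0_eq_theta_1 S_def)
    fix w :: int
    let ?e = "\<lambda>x. cis (2 * pi * of_int w * x)"
    have "integral {0..1} (\<lambda>x. of_real (theta t x - sqrt (pi / t) * (1 + S x)) * ?e x)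
        = integral {0..1} (\<lambda>x. of_real (theta t x) * ?e x - of_real (sqrt (pi / t)) * (?e x + of_real (S x) * ?e x))"
      by (simp add: algebra_simps)
    also have "\<dots> = integral {0..1} (\<lambda>x. of_real (theta t x) * ?e x)
        - integral {0..1} (\<lambda>x. of_real (sqrt (pi / t)) * (?e x + of_real (S x) * ?e x))"
      by (intro Henstock_Kurzweil_Integration.integral_diff integrable_continuous_real continuous_intros theta_continuous t S_cont)
    also have "integral {0..1} (\<lambda>x. of_real (sqrt (pi / t)) * (?e x + of_real (S x) * ?e x))
        = of_real (sqrt (pi / t)) * (integral {0..1} ?e + integral {0..1} (\<lambda>x. of_real (S x) * ?e x))"
      unfolding integral_mult_right
      by (subst Henstock_Kurzweil_Integration.integral_add)
         (auto intro!: integrable_continuous_real continuous_intros S_cont)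
    finally show "integral {0..1} (\<lambda>x. of_real (theta t x - sqrt (pi / t) * (1 + S x)) * ?e x) = 0"
      unfolding theta_fourier_coefficient[OF t] S_coeff integral_cis_int by auto
  qed
  then show ?thesis by (simp add: S_def u_def a_def)
qed

section \<open>The logarithm as an integral of the theta function\<close>

text \<open>The frequencies \<open>n + 1\<close> and \<open>- n - 1\<close> of the Fourier part combined, with the integral over
  \<open>{0<..1}\<close> replaced by the one over \<open>{0<..t}\<close>.\<close>

definition dual_term :: "real \<Rightarrow> nat \<Rightarrow> real \<Rightarrow> real" where
  "dual_term x n t = 2 * cos (2 * pi * real (Suc n) * x) * (erfc (pi * real (Suc n) / sqrt t) / real (Suc n))"

text \<open>The bound on \<open>erfc\<close> supplies a second factor \<open>1 / (n + 1)\<close>,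
  hence absolute convergence for each \<open>t\<close>. The factor \<open>sqrt t\<close> is
  unbounded, so the limit at infinity relies on the Dirichlet bounds instead.\<close>

lemma erfc_dual_bound:
  assumes "t > 0"
  shows "0 \<le> erfc (pi * real (Suc n) / sqrt t) / real (Suc n)"
    and "erfc (pi * real (Suc n) / sqrt t) / real (Suc n) \<le> sqrt t * (1 / (real (Suc n))\<^sup>2)"
proof -
  have pos: "pi * real (Suc n) / sqrt t > 0" using assms by simp
  show "0 \<le> erfc (pi * real (Suc n) / sqrt t) / real (Suc n)"
    using erfc_nonneg[OF pos] by simp
  have "erfc (pi * real (Suc n) / sqrt t) / real (Suc n) \<le> (2 / (pi * real (Suc n) / sqrt t)) / real (Suc n)"
    by (intro divide_right_mono erfc_le[OF pos]) simp
  also have "\<dots> = (2 / pi) * (sqrt t * (1 / (real (Suc n))\<^sup>2))"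
    by (simp add: power2_eq_square)
  also have "\<dots> \<le> 1 * (sqrt t * (1 / (real (Suc n))\<^sup>2))"
    using assms pi_ge_two by (intro mult_right_mono) auto
  finally show "erfc (pi * real (Suc n) / sqrt t) / real (Suc n) \<le> sqrt t * (1 / (real (Suc n))\<^sup>2)" by simp
qed

lemma summable_inverse_Suc_square: "summable (\<lambda>n. c * (1 / (real (Suc n))\<^sup>2))"
  using inverse_squares_sums by (intro summable_mult) (simp add: sums_iff add.commute)

lemma dual_term_bound:
  assumes "t > 0"
  shows "norm (dual_term x n t) \<le> 2 * sqrt t * (1 / (real (Suc n))\<^sup>2)"
proof -
  have "norm (dual_term x n t)
      = 2 * \<bar>cos (2 * pi * real (Suc n) * x)\<bar> * (erfc (pi * real (Suc n) / sqrt t) / real (Suc n))"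
    unfolding dual_term_def real_norm_def abs_mult abs_of_nonneg[OF erfc_dual_bound(1)[OF assms]] by simp
  also have "\<dots> \<le> 2 * 1 * (sqrt t * (1 / (real (Suc n))\<^sup>2))"
    by (intro mult_mono erfc_dual_bound[OF assms]) auto
  finally show ?thesis by simp
qed

lemma dual_term_summable:
  assumes "t > 0"
  shows "summable (\<lambda>n. dual_term x n t)"
  by (rule summable_comparison_test'[OF summable_inverse_Suc_square]) (rule dual_term_bound[OF assms])

text \<open>Termwise differentiation yields the dual theta series divided by \<open>t\<close>, and
  \<open>- 2 * sqrt pi / sqrt t\<close> supplies its term of frequency 0; Poisson summation
  identifies the result.\<close>

lemma DERIV_dual_series:
  assumes t: "t \<ge> 1" and x: "x \<in> {0..1}"
  shows "DERIV (\<lambda>t. - 2 * sqrt pi / sqrt t + (\<Sum>n. dual_term x n t)) t :> theta t x / t"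
proof -
  define f' where "f' n t = 2 * cos (2 * pi * real (Suc n) * x) *
      (sqrt pi / (t * sqrt t) * exp (- (pi\<^sup>2 * (real (Suc n))\<^sup>2 / t)))" for n t
  \<comment> \<open>A neighbourhood of \<open>t\<close> away from 0 and infinity: 1/2 controls
    \<open>1 / (u * sqrt u)\<close>, and \<open>t + 1\<close> the ratio of the geometric
    majorant.\<close>
  define S where "S = {1/2<..<t + 1}"
  have "((\<lambda>t. \<Sum>n. dual_term x n t) has_field_derivative (\<Sum>n. f' n t)) (at t)"
  proof (rule has_field_derivative_series'(2)[where S = S and x0 = t])
    show "(dual_term x n has_field_derivative f' n u) (at u within S)" if "u \<in> S" for n u
      unfolding dual_term_def[abs_def] f'_def using that
      by (intro DERIV_cmult has_field_derivative_at_within[OF DERIV_erfc_inverse_sqrt]) (auto simp: S_def)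
    show "uniformly_convergent_on S (\<lambda>n u. \<Sum>i<n. f' i u)"
    proof (rule Weierstrass_m_test')
      show "summable (\<lambda>n. 4 * sqrt pi * 2 * exp (- (1 / (t + 1))) ^ n)"
        using t by (intro summable_exp_minus_power) auto
      show "norm (f' n u) \<le> 4 * sqrt pi * 2 * exp (- (1 / (t + 1))) ^ n" if "u \<in> S" for n u
      proof -
        have u: "u > 1/2" "u < t + 1" using that by (auto simp: S_def)
        have "(1/2) * (1/2) \<le> u * sqrt u"
          using u by (intro mult_mono real_le_rsqrt) (auto simp: power2_eq_square)
        then have 1: "sqrt pi / (u * sqrt u) \<le> 4 * sqrt pi"
          using u by (simp add: field_simps)
        have "exp (- (pi\<^sup>2 * (real (Suc n))\<^sup>2 / u)) \<le> exp (- (1 / u)) ^ n"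
          using u by (intro gauss_dual_le) auto
        also have "\<dots> \<le> exp (- (1 / (t + 1))) ^ n"
          using u by (intro power_mono) (auto simp: field_simps)
        finally have 2: "exp (- (pi\<^sup>2 * (real (Suc n))\<^sup>2 / u)) \<le> exp (- (1 / (t + 1))) ^ n" .
        have "norm (f' n u) = (2 * \<bar>cos (2 * pi * real (Suc n) * x)\<bar>) *
            ((sqrt pi / (u * sqrt u)) * exp (- (pi\<^sup>2 * (real (Suc n))\<^sup>2 / u)))"
          using u by (simp add: f'_def abs_mult)
        also have "\<dots> \<le> (2 * 1) * ((4 * sqrt pi) * exp (- (1 / (t + 1))) ^ n)"
          using 1 2 u by (intro mult_mono) auto
        finally show ?thesis by simp
      qed
    qed
    show "summable (\<lambda>n. dual_term x n t)" using t by (intro dual_term_summable) auto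
  qed (use t in \<open>auto simp: S_def interior_open\<close>)
  moreover have "((\<lambda>t. - 2 * sqrt pi / sqrt t) has_field_derivative sqrt pi / (t * sqrt t)) (at t)"
    using t by (auto intro!: derivative_eq_intros simp: field_simps)
  ultimately have D: "((\<lambda>t. - 2 * sqrt pi / sqrt t + (\<Sum>n. dual_term x n t))
      has_field_derivative sqrt pi / (t * sqrt t) + (\<Sum>n. f' n t)) (at t)"
    by (rule DERIV_add[rotated])
  define v where "v n = 2 * cos (2 * pi * real (Suc n) * x) * exp (- (pi\<^sup>2 * (real (Suc n))\<^sup>2 / t))" for n
  have "summable v"
  proof (rule summable_comparison_test')
    show "summable (\<lambda>n. 2 * exp (- (1 / t)) ^ n)"
      using t by (intro summable_exp_minus_power) auto
    show "norm (v n) \<le> 2 * exp (- (1 / t)) ^ n" for n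
    proof -
      have "norm (v n) = 2 * \<bar>cos (2 * pi * real (Suc n) * x)\<bar> * exp (- (pi\<^sup>2 * (real (Suc n))\<^sup>2 / t))"
        by (simp add: v_def abs_mult)
      also have "\<dots> \<le> 2 * 1 * exp (- (1 / t)) ^ n"
        using t by (intro mult_mono gauss_dual_le) auto
      finally show ?thesis by simp
    qed
  qed
  then have "(\<Sum>n. sqrt pi / (t * sqrt t) * v n) = sqrt pi / (t * sqrt t) * (\<Sum>n. v n)"
    by (rule suminf_mult)
  moreover have "f' n t = sqrt pi / (t * sqrt t) * v n" for n
    by (simp add: f'_def v_def)
  moreover have "theta t x = sqrt (pi / t) * (1 + (\<Sum>n. v n))"
    unfolding v_def using t x by (intro theta_poisson) auto
  moreover have "sqrt (pi / t) / t = sqrt pi / (t * sqrt t)"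
    by (simp add: real_sqrt_divide mult.commute)
  ultimately have "theta t x / t = sqrt pi / (t * sqrt t) + (\<Sum>n. f' n t)"
    by (simp add: distrib_left add_divide_distrib real_sqrt_divide mult_ac)
  then show ?thesis using D by simp
qed

text \<open>Each \<open>erfc\<close> factor tends to 1, leaving cosines with coefficients
  \<open>2 / (n + 1)\<close>. Written as the real part of \<open>2 * z\<close> times a power series
  on the unit circle, the sum falls under \<open>tendsto_dirichlet_power_series\<close>, and its
  limit is a logarithm.\<close>

lemma tendsto_dual_series:
  assumes "cis (2 * pi * x) \<noteq> 1"
  shows "((\<lambda>t. - 2 * sqrt pi / sqrt t + (\<Sum>n. dual_term x n t))
    \<longlongrightarrow> - 2 * ln (norm (1 - cis (2 * pi * x)))) at_top"
proof -
  define z where "z = cis (2 * pi * x)"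
  have z: "norm z = 1" "z \<noteq> 1" "z \<noteq> 0" using assms by (auto simp: z_def)
  define c where "c t n = erfc (pi * real (Suc n) / sqrt t) / real (Suc n)" for t n
  have c: "decseq (c t)" "c t \<longlonglongrightarrow> 0" if "t > 0" for t
  proof -
    show "decseq (c t)"
      unfolding c_def using that
      by (intro decseq_SucI frac_le erfc_antimono erfc_nonneg) (auto intro!: divide_right_mono)
    have "(\<lambda>n. sqrt t * (1 / (real (Suc n))\<^sup>2)) \<longlonglongrightarrow> 0"
      by (rule summable_LIMSEQ_zero[OF summable_inverse_Suc_square])
    then show "c t \<longlonglongrightarrow> 0"
      by (rule tendsto_sandwich[OF _ _ tendsto_const, rotated 2])
         (use erfc_dual_bound[OF that] in \<open>auto simp: c_def\<close>)
  qed
  have lim: "((\<lambda>t. \<Sum>n. c t n *\<^sub>R z ^ n) \<longlongrightarrow> (\<Sum>n. (1 / real (Suc n)) *\<^sub>R z ^ n)) at_top"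
  proof (rule tendsto_dirichlet_power_series[OF z(1,2)])
    show "decseq (\<lambda>n. 1 / real (Suc n))" by (intro decseq_SucI) (auto simp: field_simps)
    show "(\<lambda>n. 1 / real (Suc n)) \<longlonglongrightarrow> 0"
      using LIMSEQ_inverse_real_of_nat by (simp add: inverse_eq_divide)
    show "\<forall>\<^sub>F t in at_top. decseq (c t) \<and> c t \<longlonglongrightarrow> 0"
      using c by (auto intro: eventually_mono[OF eventually_gt_at_top[of 0]])
    show "((\<lambda>t. c t n) \<longlongrightarrow> 1 / real (Suc n)) at_top" for n
    proof -
      have "filterlim (\<lambda>t. pi * real (Suc n) / sqrt t) (at_right 0) at_top"
        unfolding filterlim_at
      proof
        show "\<forall>\<^sub>F t in at_top. pi * real (Suc n) / sqrt t \<in> {0<..} \<and> pi * real (Suc n) / sqrt t \<noteq> 0"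
          by (auto intro: eventually_mono[OF eventually_gt_at_top[of 0]])
        show "((\<lambda>t. pi * real (Suc n) / sqrt t) \<longlongrightarrow> 0) at_top"
          by (intro tendsto_divide_0[OF tendsto_const] filterlim_at_top_imp_at_infinity sqrt_at_top)
      qed
      then show ?thesis
        unfolding c_def by (intro tendsto_divide filterlim_compose[OF tendsto_erfc_0]) auto
    qed
  qed
  have "((\<lambda>t. - 2 * sqrt pi / sqrt t + Re (2 * z * (\<Sum>n. c t n *\<^sub>R z ^ n)))
      \<longlongrightarrow> 0 + Re (2 * z * (\<Sum>n. (1 / real (Suc n)) *\<^sub>R z ^ n))) at_top" (is "(?f \<longlongrightarrow> ?l) _")
    by (intro tendsto_intros lim tendsto_divide_0[OF tendsto_const] filterlim_at_top_imp_at_infinity sqrt_at_top)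
  then have "((\<lambda>t. - 2 * sqrt pi / sqrt t + (\<Sum>n. dual_term x n t)) \<longlongrightarrow> ?l) at_top"
  proof (rule Lim_transform_eventually)
    show "\<forall>\<^sub>F t in at_top. ?f t = - 2 * sqrt pi / sqrt t + (\<Sum>n. dual_term x n t)"
      using eventually_gt_at_top[of 0]
    proof eventually_elim
      case (elim t)
      have "summable (\<lambda>n. c t n *\<^sub>R z ^ n)"
        by (rule dirichlet_power_series(1)[OF z(1,2) c[OF elim]])
      from sums_Re[OF sums_mult[OF summable_sums[OF this], of "2 * z"]]
      have "(\<lambda>n. Re (2 * z * (c t n *\<^sub>R z ^ n))) sums Re (2 * z * (\<Sum>n. c t n *\<^sub>R z ^ n))" .
      moreover have "Re (2 * z * (c t n *\<^sub>R z ^ n)) = dual_term x n t" for n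
      proof -
        have "2 * z * (c t n *\<^sub>R z ^ n) = (2 * c t n) *\<^sub>R z ^ Suc n"
          by (simp add: scaleR_conv_of_real)
        also have "z ^ Suc n = cis (real (Suc n) * (2 * pi * x))"
          unfolding z_def by (rule Complex.DeMoivre)
        finally show ?thesis by (simp add: dual_term_def c_def mult_ac)
      qed
      ultimately show ?case by (simp add: sums_iff)
    qed
  qed
  moreover have "?l = - 2 * ln (norm (1 - z))"
    using z by (subst suminf_power_div_Suc_unit_circle) (auto simp: Re_Ln)
  ultimately show ?thesis unfolding z_def by simp
qed

text \<open>The fundamental theorem on \<open>{1..}\<close>: the antiderivative has the logarithm as
  its limit, and its value at 1 is \<open>- 2 * sqrt pi\<close> plus the dual series. Since
  \<open>ennreal\<close> truncates negative reals to 0, recovering \<open>r\<close> requires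
  \<open>r \<ge> 0\<close>.\<close>

lemma nn_integral_theta:
  assumes x: "x \<in> {0<..<1}"
  defines "r \<equiv> 2 * sqrt pi - 2 * ln (norm (1 - cis (2 * pi * x))) - (\<Sum>n. dual_term x n 1)"
  shows "(\<integral>\<^sup>+t\<in>{1..}. ennreal (theta t x / t) \<partial>lborel) = ennreal r" and "r \<ge> 0"
proof -
  let ?F = "\<lambda>t. - 2 * sqrt pi / sqrt t + (\<Sum>n. dual_term x n t)"
  have ne: "cis (2 * pi * x) \<noteq> 1"
  proof
    assume "cis (2 * pi * x) = 1"
    then have "cos (2 * pi * x) = 1" by (simp add: complex_eq_iff)
    then obtain k :: int where "2 * pi * x = of_int k * 2 * pi" by (auto simp: cos_one_2pi_int)
    then have "x = of_int k" by simp
    then show False using x by auto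
  qed
  have x': "x \<in> {0..1}" using x by auto
  have nonneg: "0 \<le> theta t x / t" if "1 \<le> t" for t
    unfolding theta_def using that x'
    by (intro divide_nonneg_nonneg suminf_nonneg gauss_pair_summable gauss_pair_nonneg) auto
  have meas: "(\<lambda>t. theta t x / t) \<in> borel_measurable borel"
    unfolding theta_def gauss_pair_def by measurable
  note lim = tendsto_dual_series[OF ne]
  have r: "r = - 2 * ln (norm (1 - cis (2 * pi * x))) - ?F 1" by (simp add: r_def)
  show "(\<integral>\<^sup>+t\<in>{1..}. ennreal (theta t x / t) \<partial>lborel) = ennreal r"
    unfolding r
    by (rule nn_integral_FTC_atLeast[OF meas DERIV_dual_series[OF _ x'] nonneg lim])
  have "?F 1 \<le> - 2 * ln (norm (1 - cis (2 * pi * x)))"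
  proof (rule tendsto_lowerbound[OF lim])
    show "\<forall>\<^sub>F t in at_top. ?F 1 \<le> ?F t"
      using eventually_ge_at_top[of 1]
    proof eventually_elim
      case (elim t)
      show ?case
        by (rule DERIV_nonneg_imp_nondecreasing[OF elim]) (use DERIV_dual_series[OF _ x'] nonneg in blast)
    qed
  qed simp
  then show "r \<ge> 0" unfolding r by simp
qed

section \<open>The periodic logarithmic kernel\<close>

text \<open>The pairing of \<open>gauss_pair\<close>: with 0 counted among the \<open>n\<close>, the
  \<open>- n - 1\<close> are exactly the negative integers.\<close>

lemma infsum_int_ennreal:
  fixes f :: "int \<Rightarrow> ennreal"
  shows "(\<Sum>\<^sub>\<infinity>v\<in>UNIV. f v) = (\<Sum>n. f (int n) + f (- int n - 1))"
proof -
  let ?m = "\<lambda>n. - int n - 1"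
  have nat: "(\<Sum>\<^sub>\<infinity>n\<in>UNIV. g n) = (\<Sum>n. g n)" for g :: "nat \<Rightarrow> ennreal"
    using has_sum_imp_sums[OF has_sum_infsum[OF nonneg_summable_on_complete], of g] by (simp add: sums_iff)
  have "(UNIV :: int set) = range int \<union> range ?m"
  proof (intro equalityI subsetI)
    fix v :: int
    have "v = int (nat v) \<or> v = ?m (nat (- v - 1))" by auto
    then show "v \<in> range int \<union> range ?m" by blast
  qed simp
  then have "(\<Sum>\<^sub>\<infinity>v\<in>UNIV. f v) = (\<Sum>\<^sub>\<infinity>v\<in>range int \<union> range ?m. f v)" by simp
  also have "\<dots> = (\<Sum>\<^sub>\<infinity>v\<in>range int. f v) + (\<Sum>\<^sub>\<infinity>v\<in>range ?m. f v)"
    by (intro infsum_Un_disjoint nonneg_summable_on_complete) auto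
  also have "\<dots> = (\<Sum>n. f (int n)) + (\<Sum>n. f (?m n))"
    by (subst (1 2) infsum_reindex) (auto simp: inj_on_def o_def nat)
  also have "\<dots> = (\<Sum>n. f (int n) + f (?m n))"
    by (rule suminf_add) auto
  finally show ?thesis .
qed

text \<open>Here the pairing is by sign, so that conjugate frequencies merge into the cosines of
  \<open>dual_term\<close>. Absolute summability justifies splitting the unordered sum.\<close>

lemma infsum_int_nonzero_complex:
  fixes f :: "int \<Rightarrow> complex"
  assumes "summable (\<lambda>n. norm (f (int (Suc n))))" "summable (\<lambda>n. norm (f (- int (Suc n))))"
  shows "(\<lambda>n. f (int (Suc n)) + f (- int (Suc n))) sums (\<Sum>\<^sub>\<infinity>v\<in>UNIV - {0}. f v)"
proof -
  let ?p = "\<lambda>n. int (Suc n)" and ?m = "\<lambda>n. - int (Suc n)"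
  have p: "(\<lambda>n. f (?p n)) summable_on UNIV" and m: "(\<lambda>n. f (?m n)) summable_on UNIV"
    using assms by (intro norm_summable_imp_summable_on; simp)+
  have inj: "inj ?p" "inj ?m" by (auto simp: inj_on_def)
  have "(UNIV - {0} :: int set) = range ?p \<union> range ?m"
  proof (intro equalityI subsetI)
    fix v :: int assume "v \<in> UNIV - {0}"
    then have "v = ?p (nat (v - 1)) \<or> v = ?m (nat (- v - 1))" by auto
    then show "v \<in> range ?p \<union> range ?m" by blast
  qed auto
  then have "(\<Sum>\<^sub>\<infinity>v\<in>UNIV - {0}. f v) = (\<Sum>\<^sub>\<infinity>v\<in>range ?p \<union> range ?m. f v)" by simp
  also have "\<dots> = (\<Sum>\<^sub>\<infinity>v\<in>range ?p. f v) + (\<Sum>\<^sub>\<infinity>v\<in>range ?m. f v)"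
    using p m inj by (intro infsum_Un_disjoint) (auto simp: summable_on_reindex o_def)
  also have "\<dots> = (\<Sum>\<^sub>\<infinity>n. f (?p n)) + (\<Sum>\<^sub>\<infinity>n. f (?m n))"
    using infsum_reindex[OF inj(1), of f] infsum_reindex[OF inj(2), of f] by (simp add: o_def)
  finally show ?thesis
    using sums_add[OF has_sum_imp_sums[OF has_sum_infsum[OF p]] has_sum_imp_sums[OF has_sum_infsum[OF m]]]
    by simp
qed

lemma cis_frac: "cis (2 * pi * frac d) = cis (2 * pi * d)"
proof -
  have "cis (2 * pi * d) = cis (2 * pi * frac d) * cis (2 * pi * of_int \<lfloor>d\<rfloor>)"
    by (simp add: cis_mult frac_def algebra_simps)
  then show ?thesis using cis_multiple_2pi[of "of_int \<lfloor>d\<rfloor>"] by simp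
qed

text \<open>Shifting \<open>v\<close> by the floor of \<open>a - b\<close> moves the difference into
  the unit interval, and nonnegativity allows exchanging sum and integral even if the value is
  infinite.\<close>

lemma log_kernel_real_part_theta:
  assumes "x = frac (a - b)"
  shows "log_kernel_real_part a b = (\<integral>\<^sup>+t\<in>{1..}. ennreal (theta t x / t) \<partial>lborel)"
proof -
  define I where "I y = (\<integral>\<^sup>+t\<in>{1..}. ennreal (exp (- (\<bar>y\<bar>\<^sup>2 * t)) / t) \<partial>lborel)" for y :: real
  have x: "x \<in> {0..1}" using assms frac_lt_1[of "a - b"] by simp
  have "log_kernel_real_part a b = (\<Sum>\<^sub>\<infinity>v\<in>UNIV. I (x + of_int (v + \<lfloor>a - b\<rfloor>)))"
    unfolding log_kernel_real_part_def I_def assms frac_def by (simp add: algebra_simps)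
  also have "\<dots> = (\<Sum>\<^sub>\<infinity>v\<in>UNIV. I (x + of_int v))"
    by (rule infsum_reindex_bij_betw[where f = "\<lambda>v. I (x + of_int v)"])
       (rule bij_betwI[where g = "\<lambda>v. v - \<lfloor>a - b\<rfloor>"], auto)
  also have "\<dots> = (\<Sum>n. I (x + of_int (int n)) + I (x + of_int (- int n - 1)))"
    by (rule infsum_int_ennreal)
  also have "\<dots> = (\<Sum>n. \<integral>\<^sup>+t\<in>{1..}. ennreal (gauss_pair t n x / t) \<partial>lborel)"
  proof (rule suminf_cong)
    fix n
    have "I (x + of_int (int n)) + I (x + of_int (- int n - 1))
        = (\<integral>\<^sup>+t. ennreal (exp (- (\<bar>x + of_int (int n)\<bar>\<^sup>2 * t)) / t) * indicator {1..} t
            + ennreal (exp (- (\<bar>x + of_int (- int n - 1)\<bar>\<^sup>2 * t)) / t) * indicator {1..} t \<partial>lborel)"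
      unfolding I_def by (rule nn_integral_add[symmetric]) auto
    also have "\<dots> = (\<integral>\<^sup>+t\<in>{1..}. ennreal (gauss_pair t n x / t) \<partial>lborel)"
      by (intro nn_integral_cong)
         (auto simp: gauss_pair_def indicator_def add_divide_distrib algebra_simps simp flip: ennreal_plus)
    finally show "I (x + of_int (int n)) + I (x + of_int (- int n - 1))
        = (\<integral>\<^sup>+t\<in>{1..}. ennreal (gauss_pair t n x / t) \<partial>lborel)" .
  qed
  also have "\<dots> = (\<integral>\<^sup>+t. (\<Sum>n. ennreal (gauss_pair t n x / t) * indicator {1..} t) \<partial>lborel)"
    unfolding gauss_pair_def by (rule nn_integral_suminf[symmetric]) measurable
  also have "\<dots> = (\<integral>\<^sup>+t\<in>{1..}. ennreal (theta t x / t) \<partial>lborel)"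
  proof (rule nn_integral_cong)
    fix t :: real
    show "(\<Sum>n. ennreal (gauss_pair t n x / t) * indicator {1..} t) = ennreal (theta t x / t) * indicator {1..} t"
    proof (cases "t \<ge> 1")
      case True
      then have "(\<lambda>n. gauss_pair t n x / t) sums (theta t x / t)"
        unfolding theta_def using x by (intro sums_divide summable_sums gauss_pair_summable) auto
      then have "(\<Sum>n. ennreal (gauss_pair t n x / t)) = ennreal (theta t x / t)"
        using True gauss_pair_nonneg by (intro suminf_ennreal_eq) auto
      then show ?thesis using True by simp
    qed simp
  qed
  finally show ?thesis .
qed

text \<open>The integral depends on \<open>w\<close> only through \<open>\<bar>w\<bar>\<close>, so
  the terms at \<open>w\<close> and \<open>- w\<close> add up to a cosine whose coefficient is given
  by \<open>fourier_part_integral\<close>.\<close>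

lemma log_kernel_fourier_part_dual:
  assumes "x = frac (a - b)"
  shows "Re (log_kernel_fourier_part a b) = (\<Sum>n. dual_term x n 1)"
proof -
  define c where "c w = erfc (pi * \<bar>of_int w\<bar>) / \<bar>of_int w\<bar>" for w :: int
  define f where "f w = exp (2 * of_real pi * \<i> * of_int w * of_real (a - b)) *
        complex_of_real (LINT t:{0<..1}|lborel.
          pi powr (1/2) / t powr (3/2) * exp (- (pi\<^sup>2 * (of_int w)\<^sup>2 / t)))" for w :: int
  have f: "f w = cis (2 * pi * x) powi w * of_real (c w)" if "w \<noteq> 0" for w
  proof -
    have "exp (2 * of_real pi * \<i> * of_int w * of_real (a - b)) = cis (of_int w * (2 * pi * (a - b)))"
      by (simp add: cis_conv_exp mult_ac)
    also have "\<dots> = cis (2 * pi * x) powi w"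
      by (simp only: assms cis_frac cis_power_int)
    finally show ?thesis
      using fourier_part_integral[of "\<bar>of_int w\<bar>"] that by (simp add: f_def c_def)
  qed
  have c: "0 \<le> c (int (Suc n))" "c (int (Suc n)) \<le> 1 * (1 / (real (Suc n))\<^sup>2)" "c (- int (Suc n)) = c (int (Suc n))" for n
    using erfc_dual_bound[of 1 n] by (simp_all add: c_def add.commute)
  have sm: "summable (\<lambda>n. c (int (Suc n)))"
    by (rule summable_comparison_test'[OF summable_inverse_Suc_square[of 1]]) (use c in auto)
  have norm_p: "norm (f (int (Suc n))) = c (int (Suc n))" and norm_m: "norm (f (- int (Suc n))) = c (int (Suc n))" for n
    using c[of n] by (simp_all add: f norm_mult norm_power_int)
  have "(\<lambda>n. f (int (Suc n)) + f (- int (Suc n))) sums log_kernel_fourier_part a b"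
    unfolding log_kernel_fourier_part_def f_def[symmetric]
    by (rule infsum_int_nonzero_complex) (simp_all only: norm_p norm_m sm)
  then have "(\<lambda>n. Re (f (int (Suc n)) + f (- int (Suc n)))) sums Re (log_kernel_fourier_part a b)"
    by (rule sums_Re)
  moreover have "Re (f (int (Suc n)) + f (- int (Suc n))) = dual_term x n 1" for n
  proof -
    have powi: "cis (2 * pi * x) powi w = cis (2 * pi * of_int w * x)" for w :: int
      by (subst cis_power_int) (simp add: mult_ac)
    have "cis (2 * pi * x) powi (int (Suc n)) = cis (2 * pi * real (Suc n) * x)"
      using powi[of "int (Suc n)"] by (simp only: of_int_of_nat_eq)
    moreover have "cis (2 * pi * x) powi (- int (Suc n)) = cis (- (2 * pi * real (Suc n) * x))"
      using powi[of "- int (Suc n)"]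
      by (simp only: of_int_minus of_int_of_nat_eq mult_minus_left mult_minus_right)
    ultimately show ?thesis
      using c(3)[of n] by (simp add: f dual_term_def c_def del: of_nat_Suc)
  qed
  ultimately show ?thesis by (simp add: sums_iff)
qed

text \<open>The dual series at 1 is subtracted in the real-space part and equals the Fourier part,
  so it cancels.\<close>

theorem periodic_log_kernel_eq:
  assumes "x - y \<notin> \<int>"
  shows "periodic_log_kernel x y = ereal (2 * sqrt pi - 2 * ln (norm (1 - cis (2 * pi * (x - y)))))"
proof -
  define u where "u = frac (x - y)"
  have u: "u \<in> {0<..<1}"
    using assms frac_lt_1[of "x - y"] by (auto simp: u_def frac_gt_0_iff)
  show ?thesis
    unfolding periodic_log_kernel_def log_kernel_real_part_theta[OF u_def] log_kernel_fourier_part_dual[OF u_def]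
      nn_integral_theta(1)[OF u]
    using nn_integral_theta(2)[OF u] by (simp add: u_def cis_frac enn2ereal_ennreal)
qed

text \<open>Restricting to \<open>{1..exp (real n)}\<close> already gives \<open>n\<close>.\<close>

lemma nn_integral_inverse_at_top: "(\<integral>\<^sup>+t\<in>{1..}. ennreal (1 / t) \<partial>lborel) = \<infinity>"
proof (rule ccontr)
  assume "(\<integral>\<^sup>+t\<in>{1..}. ennreal (1 / t) \<partial>lborel) \<noteq> \<infinity>"
  then obtain n where n: "(\<integral>\<^sup>+t\<in>{1..}. ennreal (1 / t) \<partial>lborel) < of_nat n"
    using ennreal_Ex_less_of_nat by (auto simp: less_top)
  have "(\<integral>\<^sup>+t. ennreal (1 / t) * indicator {1..exp (real n)} t \<partial>lborel) = ennreal (ln (exp (real n)) - ln 1)"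
    by (rule nn_integral_FTC_Icc) (auto intro!: derivative_eq_intros)
  moreover have "(\<integral>\<^sup>+t. ennreal (1 / t) * indicator {1..exp (real n)} t \<partial>lborel) \<le> (\<integral>\<^sup>+t\<in>{1..}. ennreal (1 / t) \<partial>lborel)"
    by (intro nn_integral_mono) (auto simp: indicator_def)
  ultimately have "of_nat n \<le> (\<integral>\<^sup>+t\<in>{1..}. ennreal (1 / t) \<partial>lborel)"
    by (simp add: ennreal_of_nat_eq_real_of_nat)
  then show False using n by simp
qed

text \<open>One translate suffices: at \<open>v = - (x - y)\<close> the integrand is
  \<open>1 / t\<close>.\<close>

lemma periodic_log_kernel_infinite:
  assumes "x - y \<in> \<int>"
  shows "periodic_log_kernel x y = \<infinity>"
proof -
  let ?I = "\<lambda>v::int. \<integral>\<^sup>+t\<in>{1..}. ennreal (exp (- (\<bar>x - y + of_int v\<bar>\<^sup>2 * t)) / t) \<partial>lborel"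
  obtain k where k: "x - y = of_int k" using assms by (auto elim: Ints_cases)
  have "\<infinity> = infsum ?I {- k}"
    using nn_integral_inverse_at_top by (simp add: k)
  also have "\<dots> \<le> infsum ?I UNIV"
    by (intro infsum_mono_neutral nonneg_summable_on_complete) auto
  finally have "log_kernel_real_part x y = \<infinity>"
    by (simp add: log_kernel_real_part_def top.extremum_unique)
  then show ?thesis by (simp add: periodic_log_kernel_def)
qed

section \<open>Minimal energy\<close>

text \<open>Distance of two points of the unit circle whose angles differ by
  \<open>2 * pi * d\<close>; up to a constant the kernel is \<open>- 2 * ln\<close> of it.\<close>

definition chord :: "real \<Rightarrow> real" where
  "chord d = norm (1 - cis (2 * pi * d))"

lemma chord_minus [simp]: "chord (- d) = chord d"
proof -
  have "1 - cis (2 * pi * - d) = cnj (1 - cis (2 * pi * d))"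
    by (simp add: cis_cnj)
  then show ?thesis unfolding chord_def by (simp only: complex_mod_cnj)
qed

lemma chord_add_int: "chord (d + of_int k) = chord d"
proof -
  have "cis (2 * pi * (d + of_int k)) = cis (2 * pi * d) * cis (2 * pi * of_int k)"
    by (simp add: cis_mult algebra_simps)
  then show ?thesis
    using cis_multiple_2pi[of "of_int k"] by (simp add: chord_def)
qed

lemma chord_eq_sin:
  assumes "u \<in> {0<..<1}"
  shows "chord u = 2 * sin (pi * u)" and "sin (pi * u) > 0"
proof -
  show pos: "sin (pi * u) > 0" using assms by (intro sin_gt_zero) auto
  have "chord u = norm (exp (\<i> * of_real (2 * pi * u)) - 1)"
    unfolding chord_def cis_conv_exp by (rule norm_minus_commute)
  also have "\<dots> = 2 * \<bar>sin (pi * u)\<bar>"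
    by (subst dist_exp_i_1) simp
  finally show "chord u = 2 * sin (pi * u)" using pos by simp
qed

text \<open>Convexity of \<open>- ln (2 * sin (pi * u))\<close> on the open unit interval: the
  second derivative is \<open>pi^2\<close> over the squared sine, so the graph stays above its
  tangent at \<open>v\<close>.\<close>

lemma ln_chord_le_tangent:
  assumes "u \<in> {0<..<1}" "v \<in> {0<..<1}"
  shows "ln (chord u) \<le> ln (chord v) + pi * cos (pi * v) / sin (pi * v) * (u - v)"
proof -
  have "(- (pi * cos (pi * v) / sin (pi * v))) * (u - v) \<le> - ln (2 * sin (pi * u)) - - ln (2 * sin (pi * v))"
  \<comment> \<open>The sum of squares equals 1; it keeps the shape in which the quotient rule
    produces it.\<close>
  proof (rule f''_imp_f'[where C = "{0<..<1}" and f'' = "\<lambda>u. pi\<^sup>2 * ((sin (pi * u))\<^sup>2 + (cos (pi * u))\<^sup>2) / (sin (pi * u))\<^sup>2"])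
    fix u :: real assume u: "u \<in> {0<..<1}"
    note pos = chord_eq_sin(2)[OF u]
    show "DERIV (\<lambda>u. - ln (2 * sin (pi * u))) u :> - (pi * cos (pi * u) / sin (pi * u))"
      using pos by (auto intro!: derivative_eq_intros)
    show "DERIV (\<lambda>u. - (pi * cos (pi * u) / sin (pi * u))) u :>
        pi\<^sup>2 * ((sin (pi * u))\<^sup>2 + (cos (pi * u))\<^sup>2) / (sin (pi * u))\<^sup>2"
      using pos by (auto intro!: derivative_eq_intros simp: power2_eq_square field_simps
        simp del: sin_cos_squared_add sin_cos_squared_add2 sin_cos_squared_add3)
  qed (use assms in auto)
  then show ?thesis using assms by (simp add: chord_eq_sin algebra_simps)
qed

text \<open>Factor \<open>z ^ N - 1\<close> as \<open>(z - 1) * Q z\<close>, with \<open>Q\<close>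
  the product over the other roots. The derivative at 1 is \<open>Q 1\<close> by the product rule
  and \<open>N\<close> by direct computation.\<close>

lemma prod_one_minus_roots_of_unity:
  assumes "N \<ge> 1"
  shows "(\<Prod>\<zeta>\<in>{z::complex. z ^ N = 1} - {1}. 1 - \<zeta>) = of_nat N"
proof -
  define p :: "complex poly" where "p = monom 1 N + [:-1:]"
  have p: "poly p z = z ^ N - 1" "poly (pderiv p) z = of_nat N * z ^ (N - 1)" for z
    by (simp_all add: p_def poly_monom pderiv_add pderiv_monom pderiv_pCons)
  have deg: "lead_coeff p = 1"
  proof -
    have "degree p = N"
      unfolding p_def using assms by (subst degree_add_eq_left) (auto simp: degree_monom_eq)
    then show ?thesis using assms by (simp add: p_def coeff_pCons split: nat.split)
  qed
  have "rsquarefree p"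
    unfolding rsquarefree_roots p using assms by (auto simp: power_0_left)
  from complex_poly_decompose_rsquarefree[OF this]
  have "(\<Prod>z | z ^ N = 1. [:-z, 1:]) = p" by (simp add: deg p)
  moreover have "(\<Prod>z | z ^ N = (1::complex). [:-z, 1:]) = [:- 1, 1:] * (\<Prod>z\<in>{z. z ^ N = 1} - {1}. [:-z, 1:])"
    using assms by (intro prod.remove finite_roots_unity) auto
  ultimately have "p = [:- 1, 1:] * (\<Prod>z\<in>{z. z ^ N = 1} - {1}. [:-z, 1:])" by simp
  moreover have "poly (pderiv ([:- 1, 1:] * Q)) 1 = poly Q 1" for Q :: "complex poly"
    by (simp only: pderiv_mult poly_add poly_mult) (simp add: pderiv_pCons)
  ultimately have "poly (pderiv p) 1 = poly (\<Prod>z\<in>{z. z ^ N = 1} - {1}. [:-z, 1:]) 1"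
    by metis
  then show ?thesis by (simp add: p poly_prod)
qed

text \<open>The chords from 1 to the other roots of unity have product \<open>N\<close>; none of
  them is 0, so the logarithm splits.\<close>

lemma sum_ln_chord_equidistant:
  assumes "N \<ge> 1"
  shows "(\<Sum>k\<in>{1..<N}. ln (chord (real k / real N))) = ln (real N)"
proof -
  let ?r = "\<lambda>k. cis (2 * pi * real k / real N)"
  have "bij_betw ?r {..<N} {z. z ^ N = 1}"
    using assms Complex.bij_betw_roots_unity[of N] by simp
  then have bij: "bij_betw ?r ({..<N} - {0}) ({z. z ^ N = 1} - {?r 0})"
    using assms by (intro bij_betw_DiffI) (auto simp: bij_betw_def)
  have "real N = norm (\<Prod>\<zeta>\<in>{z::complex. z ^ N = 1} - {1}. 1 - \<zeta>)"
    by (simp add: prod_one_minus_roots_of_unity[OF assms])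
  also have "\<dots> = norm (\<Prod>k\<in>{..<N} - {0}. 1 - ?r k)"
    using prod.reindex_bij_betw[OF bij, of "\<lambda>\<zeta>. 1 - \<zeta>"] by simp
  also have "\<dots> = (\<Prod>k\<in>{..<N} - {0}. chord (real k / real N))"
    by (simp add: prod_norm chord_def)
  also have "{..<N} - {0} = {1..<N}" by auto
  finally have "ln (real N) = ln (\<Prod>k\<in>{1..<N}. chord (real k / real N))" by simp
  also have "\<dots> = (\<Sum>k\<in>{1..<N}. ln (chord (real k / real N)))"
  proof -
    have "chord (real k / real N) \<noteq> 0" if "k \<in> {1..<N}" for k
      using chord_eq_sin[of "real k / real N"] that by simp
    then show ?thesis by (intro ln_prod) simp_all
  qed
  finally show ?thesis by simp
qed

section \<open>Sums over pairs, grouped by cyclic offset\<close>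

lemma bij_betw_add_mod:
  assumes "k < N"
  shows "bij_betw (\<lambda>i. (i + k) mod N) {..<N} {..<(N::nat)}"
proof (rule bij_betw_byWitness[where f' = "\<lambda>j. (j + (N - k)) mod N"])
  show "\<forall>i\<in>{..<N}. ((i + k) mod N + (N - k)) mod N = i"
    using assms by (simp only: mod_add_left_eq) simp
  show "\<forall>j\<in>{..<N}. ((j + (N - k)) mod N + k) mod N = j"
    using assms by (simp only: mod_add_left_eq) simp
qed (use assms in auto)

lemma bij_betw_cyclic_shift:
  fixes i N :: nat
  assumes "i < N"
  shows "bij_betw (\<lambda>k. (i + k) mod N) {1..<N} ({..<N} - {i})"
proof -
  have "bij_betw (\<lambda>k. (k + i) mod N) ({..<N} - {0}) ({..<N} - {(0 + i) mod N})"
    using assms by (intro bij_betw_DiffI bij_betw_add_mod) (auto simp: bij_betw_def)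
  moreover have "{..<N} - {0} = {1..<N}" by auto
  ultimately show ?thesis using assms by (simp add: add.commute)
qed

text \<open>For fixed \<open>i\<close>, the index \<open>(i + k) mod N\<close> meets every other
  index once as \<open>k\<close> varies. Grouping by \<open>k\<close> isolates the pairs to which
  concavity applies.\<close>

lemma sum_off_diagonal_cyclic:
  fixes F :: "nat \<Rightarrow> nat \<Rightarrow> 'a::comm_monoid_add"
  shows "(\<Sum>i<N. \<Sum>j\<in>{..<N} - {i}. F i j) = (\<Sum>k\<in>{1..<N}. \<Sum>i<N. F i ((i + k) mod N))"
proof -
  have "(\<Sum>i<N. \<Sum>j\<in>{..<N} - {i}. F i j) = (\<Sum>i<N. \<Sum>k\<in>{1..<N}. F i ((i + k) mod N))"
    by (intro sum.cong refl sum.reindex_bij_betw[symmetric] bij_betw_cyclic_shift) auto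
  also have "\<dots> = (\<Sum>k\<in>{1..<N}. \<Sum>i<N. F i ((i + k) mod N))"
    by (rule sum.swap)
  finally show ?thesis .
qed

text \<open>For each offset \<open>k\<close> this is Jensen's inequality through tangents at the
  mean gap \<open>k / N\<close>: the gaps add up to \<open>k\<close>, so the linear terms
  cancel.\<close>

lemma sum_ln_chord_le:
  fixes y :: "nat \<Rightarrow> real"
  assumes N: "N \<ge> 1" and y: "\<And>i. i < N \<Longrightarrow> y i \<in> {0..<1}" and mono: "\<And>i j. i < j \<Longrightarrow> j < N \<Longrightarrow> y i < y j"
  shows "(\<Sum>i<N. \<Sum>j\<in>{..<N} - {i}. ln (chord (y j - y i))) \<le> real N * ln (real N)"
proof -
  have "(\<Sum>i<N. ln (chord (y ((i + k) mod N) - y i))) \<le> real N * ln (chord (real k / real N))"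
    if k: "k \<in> {1..<N}" for k
  proof -
    \<comment> \<open>\<open>w i\<close> marks a wrap past index \<open>N - 1\<close>. Adding the
      full turn brings the gap into \<open>{0<..<1}\<close> and leaves the chord unchanged.\<close>
    define w where "w i = (if N \<le> i + k then 1 else 0 :: nat)" for i
    define d where "d i = y ((i + k) mod N) - y i + real (w i)" for i
    define v where "v = real k / real N"
    have v: "v \<in> {0<..<1}" using k by (auto simp: v_def)
    have chord_d: "chord (y ((i + k) mod N) - y i) = chord (d i)" for i
      unfolding d_def using chord_add_int[of _ "int (w i)"] by simp
    have d: "d i \<in> {0<..<1}" if i: "i < N" for i
    proof (cases "N \<le> i + k")
      case True
      then have "(i + k) mod N = i + k - N" using k i by (simp add: le_mod_geq)
      moreover have "y (i + k - N) < y i" using True k i by (intro mono) auto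
      moreover have "y (i + k - N) \<in> {0..<1}" "y i \<in> {0..<1}" using True k i by (intro y; auto)+
      ultimately show ?thesis using True by (auto simp: d_def w_def)
    next
      case False
      then have "y i < y (i + k)" using k by (intro mono) auto
      moreover have "y (i + k) \<in> {0..<1}" "y i \<in> {0..<1}" using False i by (intro y; auto)+
      ultimately show ?thesis using False by (auto simp: d_def w_def)
    qed
    \<comment> \<open>The shift permutes the indices, so the points cancel from the sum of the gaps;
      wraps occur exactly for the last \<open>k\<close> indices.\<close>
    have "(\<Sum>i<N. y ((i + k) mod N)) = (\<Sum>i<N. y i)"
      using k by (intro sum.reindex_bij_betw bij_betw_add_mod) auto
    moreover have "(\<Sum>i<N. w i) = k"
    proof -
      have "(\<Sum>i<N. w i) = card {i\<in>{..<N}. N \<le> i + k}"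
        unfolding w_def by (simp add: sum.If_cases Int_def)
      also have "{i\<in>{..<N}. N \<le> i + k} = {N - k..<N}" using k by auto
      finally show ?thesis using k by simp
    qed
    then have "(\<Sum>i<N. real (w i)) = real k" by (metis of_nat_sum)
    ultimately have sum_d: "(\<Sum>i<N. d i - v) = 0"
      using N by (simp add: d_def v_def sum.distrib sum_subtractf)
    have "(\<Sum>i<N. ln (chord (y ((i + k) mod N) - y i)))
        \<le> (\<Sum>i<N. ln (chord v) + pi * cos (pi * v) / sin (pi * v) * (d i - v))"
      unfolding chord_d by (intro sum_mono ln_chord_le_tangent d v) auto
    also have "\<dots> = real N * ln (chord v) + pi * cos (pi * v) / sin (pi * v) * (\<Sum>i<N. d i - v)"
      by (simp add: sum.distrib sum_distrib_left)
    finally show ?thesis unfolding sum_d by (simp add: v_def)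
  qed
  then have "(\<Sum>i<N. \<Sum>j\<in>{..<N} - {i}. ln (chord (y j - y i))) \<le> (\<Sum>k\<in>{1..<N}. real N * ln (chord (real k / real N)))"
    unfolding sum_off_diagonal_cyclic by (intro sum_mono)
  then show ?thesis
    by (simp only: sum_distrib_left[symmetric] sum_ln_chord_equidistant[OF N])
qed

text \<open>The equality case: every gap of offset \<open>k\<close> is \<open>k / N\<close> up to an
  integer.\<close>

lemma sum_ln_chord_equidistant_pairs:
  assumes N: "N \<ge> 1"
  shows "(\<Sum>i<N. \<Sum>j\<in>{..<N} - {i}. ln (chord (real j / real N - real i / real N))) = real N * ln (real N)"
proof -
  have "chord (real ((i + k) mod N) / real N - real i / real N) = chord (real k / real N)" for i k
  proof -
    have "real (i + k) = real ((i + k) mod N) + real N * real ((i + k) div N)"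
      by (metis of_nat_add of_nat_mult mod_mult_div_eq)
    then have "real ((i + k) mod N) / real N - real i / real N = real k / real N + of_int (- int ((i + k) div N))"
      using N by (simp add: field_simps)
    then show ?thesis by (simp only: chord_add_int)
  qed
  then have "(\<Sum>i<N. \<Sum>j\<in>{..<N} - {i}. ln (chord (real j / real N - real i / real N)))
      = (\<Sum>k\<in>{1..<N}. real N * ln (chord (real k / real N)))"
    unfolding sum_off_diagonal_cyclic by simp
  then show ?thesis
    by (simp only: sum_distrib_left[symmetric] sum_ln_chord_equidistant[OF N])
qed

text \<open>Serves two relabellings: sorting of distinct points, and the shift from
  \<open>{..<N}\<close> to \<open>{1..N}\<close> for equidistant ones.\<close>

lemma sum_off_diagonal_reindex:
  fixes F :: "'a \<Rightarrow> 'a \<Rightarrow> 'c::comm_monoid_add"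
  assumes h: "bij_betw h A B" and B: "finite B"
  shows "(\<Sum>(j, k)\<in>{(j, k). j \<in> B \<and> k \<in> B \<and> j \<noteq> k}. F j k) = (\<Sum>i\<in>A. \<Sum>l\<in>A - {i}. F (h i) (h l))"
proof -
  have "{(j, k). j \<in> B \<and> k \<in> B \<and> j \<noteq> k} = Sigma B (\<lambda>j. B - {j})" by auto
  then have "(\<Sum>(j, k)\<in>{(j, k). j \<in> B \<and> k \<in> B \<and> j \<noteq> k}. F j k) = (\<Sum>j\<in>B. \<Sum>k\<in>B - {j}. F j k)"
    using B by (simp add: sum.Sigma)
  also have "\<dots> = (\<Sum>i\<in>A. \<Sum>k\<in>B - {h i}. F (h i) k)"
    by (rule sum.reindex_bij_betw[OF h, symmetric])
  also have "\<dots> = (\<Sum>i\<in>A. \<Sum>l\<in>A - {i}. F (h i) (h l))"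
  proof (intro sum.cong refl)
    fix i assume "i \<in> A"
    then have "bij_betw h (A - {i}) (B - {h i})"
      using h by (intro bij_betw_DiffI) (auto simp: bij_betw_def)
    then show "(\<Sum>k\<in>B - {h i}. F (h i) k) = (\<Sum>l\<in>A - {i}. F (h i) (h l))"
      by (rule sum.reindex_bij_betw[symmetric])
  qed
  finally show ?thesis .
qed

text \<open>Distinct points of \<open>{0..<1}\<close> differ by less than 1, so never by an integer,
  and the closed form of the kernel applies to all \<open>N * (N - 1)\<close> ordered pairs.\<close>

lemma sum_periodic_log_kernel:
  fixes y :: "nat \<Rightarrow> real"
  assumes y: "\<And>i. i < N \<Longrightarrow> y i \<in> {0..<1}" and inj: "inj_on y {..<N}"
  shows "(\<Sum>i<N. \<Sum>j\<in>{..<N} - {i}. periodic_log_kernel (y i) (y j))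
    = ereal (2 * sqrt pi * (real N * (real N - 1)) - 2 * (\<Sum>i<N. \<Sum>j\<in>{..<N} - {i}. ln (chord (y j - y i))))"
proof -
  have "periodic_log_kernel (y i) (y j) = ereal (2 * sqrt pi - 2 * ln (chord (y j - y i)))"
    if i: "i < N" and j: "j \<in> {..<N} - {i}" for i j
  proof -
    have ne: "y i \<noteq> y j" using inj i j by (auto simp: inj_on_def)
    have "y i - y j \<notin> \<int>"
    proof
      assume "y i - y j \<in> \<int>"
      then obtain k :: int where k: "y i - y j = of_int k" by (auto elim: Ints_cases)
      have "\<bar>y i - y j\<bar> < 1" using y[of i] y[of j] i j by auto
      then have "\<bar>k\<bar> < 1" unfolding k by linarith
      then show False using k ne by simp
    qed
    then show ?thesis
      using chord_minus[of "y i - y j"] by (simp add: periodic_log_kernel_eq flip: chord_def)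
  qed
  then have "(\<Sum>i<N. \<Sum>j\<in>{..<N} - {i}. periodic_log_kernel (y i) (y j))
      = (\<Sum>i<N. \<Sum>j\<in>{..<N} - {i}. ereal (2 * sqrt pi - 2 * ln (chord (y j - y i))))"
    by (intro sum.cong refl) auto
  also have "\<dots> = ereal (\<Sum>i<N. \<Sum>j\<in>{..<N} - {i}. 2 * sqrt pi - 2 * ln (chord (y j - y i)))"
    by simp
  also have "(\<Sum>i<N. \<Sum>j\<in>{..<N} - {i}. 2 * sqrt pi - 2 * ln (chord (y j - y i)))
      = (\<Sum>i<N. \<Sum>j\<in>{..<N} - {i}. 2 * sqrt pi) - 2 * (\<Sum>i<N. \<Sum>j\<in>{..<N} - {i}. ln (chord (y j - y i)))"
    by (simp add: sum_subtractf sum_distrib_left)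
  also have "(\<Sum>i<N. \<Sum>j\<in>{..<N} - {i}. 2 * sqrt pi) = 2 * sqrt pi * (real N * (real N - 1))"
    by (cases N) simp_all
  finally show ?thesis .
qed

theorem theorem5p5:
  fixes N :: nat
  assumes "N \<ge> 1"
  shows "periodic_log_energy {0..<1} N =
           ereal (2 * real N * (sqrt pi * (real N - 1) - ln (real N)))"
proof -
  let ?E = "\<lambda>x. \<Sum>(j, k) \<in> {(j, k). j \<in> {1..N} \<and> k \<in> {1..N} \<and> j \<noteq> k}. periodic_log_kernel (x j) (x k)"
  let ?m = "2 * real N * (sqrt pi * (real N - 1) - ln (real N))"
  have lower: "ereal ?m \<le> ?E x" if x: "x \<in> {1..N} \<rightarrow>\<^sub>E {0..<1}" for x
  proof (cases "inj_on x {1..N}")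
    case True
    \<comment> \<open>The energy does not depend on the labelling, so the points may be listed in
      increasing order, as \<open>sum_ln_chord_le\<close> requires.\<close>
    define L where "L = sorted_list_of_set (x ` {1..N})"
    define y where "y i = L ! i" for i
    have L: "length L = N" "set L = x ` {1..N}" "sorted_wrt (<) L" "distinct L"
      using card_image[OF True] by (auto simp: L_def)
    have bij_y: "bij_betw y {..<N} (x ` {1..N})"
      unfolding y_def by (rule bij_betw_nth) (use L in auto)
    define h where "h = the_inv_into {1..N} x \<circ> y"
    have h: "bij_betw h {..<N} {1..N}"
      unfolding h_def by (rule bij_betw_trans[OF bij_y bij_betw_the_inv_into]) (use True in \<open>auto simp: bij_betw_def\<close>)
    have xh: "x (h i) = y i" if "i < N" for i
      using f_the_inv_into_f[OF True, of "y i"] bij_betwE[OF bij_y] that by (auto simp: h_def)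
    have y01: "y i \<in> {0..<1}" if "i < N" for i
    proof -
      have "y i \<in> x ` {1..N}" using bij_betwE[OF bij_y] that by blast
      then show ?thesis using PiE_mem[OF x] by auto
    qed
    have mono: "y i < y j" if "i < j" "j < N" for i j
      unfolding y_def using L that by (intro sorted_wrt_nth_less) auto
    have "?E x = (\<Sum>i<N. \<Sum>j\<in>{..<N} - {i}. periodic_log_kernel (y i) (y j))"
      unfolding sum_off_diagonal_reindex[OF h finite_atLeastAtMost] by (intro sum.cong refl) (auto simp: xh)
    also have "\<dots> = ereal (2 * sqrt pi * (real N * (real N - 1)) - 2 * (\<Sum>i<N. \<Sum>j\<in>{..<N} - {i}. ln (chord (y j - y i))))"
      using bij_y by (intro sum_periodic_log_kernel y01) (auto simp: bij_betw_def)
    also have "\<dots> \<ge> ereal (2 * sqrt pi * (real N * (real N - 1)) - 2 * (real N * ln (real N)))"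
      using sum_ln_chord_le[OF assms y01 mono] by simp
    also have "2 * sqrt pi * (real N * (real N - 1)) - 2 * (real N * ln (real N)) = ?m"
      by (simp add: algebra_simps)
    finally show ?thesis .
  next
    case False
    \<comment> \<open>Coinciding points have an infinite kernel value, and one infinite term makes
      the whole sum infinite.\<close>
    then obtain j k where jk: "j \<in> {1..N}" "k \<in> {1..N}" "j \<noteq> k" "x j = x k" by (auto simp: inj_on_def)
    let ?P = "{(j, k). j \<in> {1..N} \<and> k \<in> {1..N} \<and> j \<noteq> k}"
    have "finite ?P" by (rule finite_subset[of _ "{1..N} \<times> {1..N}"]) auto
    moreover have "(j, k) \<in> ?P" using jk by simp
    moreover have "(case (j, k) of (j, k) \<Rightarrow> periodic_log_kernel (x j) (x k)) = \<infinity>"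
      using jk by (simp add: periodic_log_kernel_infinite)
    ultimately have "?E x = \<infinity>"
      unfolding sum_Pinfty by blast
    then show ?thesis by simp
  qed
  \<comment> \<open>Equidistant points attain the bound; indices start at 1, hence
    \<open>real j - 1\<close>.\<close>
  define x where "x = (\<lambda>j\<in>{1..N}. (real j - 1) / real N)"
  have x: "x \<in> {1..N} \<rightarrow>\<^sub>E {0..<1}" by (auto simp: x_def)
  have "bij_betw Suc {..<N} {1..N}"
    by (rule bij_betwI[where g = "\<lambda>j. j - 1"]) auto
  then have "?E x = (\<Sum>i<N. \<Sum>j\<in>{..<N} - {i}. periodic_log_kernel (x (Suc i)) (x (Suc j)))"
    by (rule sum_off_diagonal_reindex) simp
  also have "\<dots> = (\<Sum>i<N. \<Sum>j\<in>{..<N} - {i}. periodic_log_kernel (real i / real N) (real j / real N))"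
    by (intro sum.cong refl) (auto simp: x_def)
  also have "\<dots> = ereal (2 * sqrt pi * (real N * (real N - 1)) - 2 * (real N * ln (real N)))"
    unfolding sum_ln_chord_equidistant_pairs[OF assms, symmetric]
    by (rule sum_periodic_log_kernel) (auto simp: inj_on_def)
  also have "2 * sqrt pi * (real N * (real N - 1)) - 2 * (real N * ln (real N)) = ?m"
    by (simp add: algebra_simps)
  finally have attained: "?E x = ereal ?m" .
  show ?thesis
    unfolding periodic_log_energy_def
  proof (rule antisym)
    show "(INF x\<in>{1..N} \<rightarrow>\<^sub>E {0..<1}. ?E x) \<le> ereal ?m"
      using INF_lower[OF x, of ?E] unfolding attained .
    show "ereal ?m \<le> (INF x\<in>{1..N} \<rightarrow>\<^sub>E {0..<1}. ?E x)"
      by (rule INF_greatest) (rule lower)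
  qed
qed

end
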